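(* Let $f$ be a polynomial of degree $d\geq 2$ with complex coefficients, and let $G$ be a Siegel disk of $f$. If the boundary $\partial G$ contains a periodic point of $f$, then $\partial G$ is an indecomposable continuum.
   Context: A polynomial $f$ is regarded as a rational map of the Riemann sphere $\overline{\mathbb{C}}$. A component $G$ of the Fatou set of $f$ is a Siegel disk if $f(G)=G$, $G$ contains a neutral fixed point $w_0$ (that is, $f(w_0)=w_0$ and $|f'(w_0)|=1$), and $f|_G$ is analytically conjugate to a rotation. It is known that then $f'(w_0)=e^{2\pi i\theta}$ with $\theta$ irrational. An indecomposable continuum is a compact connected space $X$ that cannot be written as a union $A\cup B$ with $A$ and $B$ connected closed proper subsets of $X$. *)

theory Defs
  imports "HOL-Complex_Analysis.Complex_Analysis" "HOL-Computational_Algebra.Polynomial"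
begin

abbreviation riemann_sphere :: "complex option topology" where
  "riemann_sphere \<equiv> Alexandroff_compactification euclidean"

(* Only meant for non-constant p, where infinity is a fixed point. *)
definition sphere_map :: "complex poly \<Rightarrow> complex option \<Rightarrow> complex option" where
  "sphere_map p = map_option (poly p)"

(* Inverse stereographic projection onto the unit sphere of complex \<times> real; the chordal
   (spherical) metric is the Euclidean distance between the images. *)
fun stereo :: "complex option \<Rightarrow> complex \<times> real" where
  "stereo None = (0, 1)"
| "stereo (Some z) =
     ((2 / ((norm z)\<^sup>2 + 1)) *\<^sub>R z, ((norm z)\<^sup>2 - 1) / ((norm z)\<^sup>2 + 1))"

(* The iterates of F are a normal family on U: any sequence of iterates (indices k n, in any order
   and possibly repeating) has a subsequence converging in the chordal metric, uniformly on
   compact subsets of U. The constant limit infinity is allowed. *)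
definition iterates_normal_on ::
    "(complex option \<Rightarrow> complex option) \<Rightarrow> complex option set \<Rightarrow> bool" where
  "iterates_normal_on F U \<longleftrightarrow>
     (\<forall>k :: nat \<Rightarrow> nat. \<exists>r g. strict_mono (r :: nat \<Rightarrow> nat) \<and>
        (\<forall>K. compactin riemann_sphere K \<and> K \<subseteq> U \<longrightarrow>
           uniform_limit K (\<lambda>n z. stereo ((F ^^ k (r n)) z)) (\<lambda>z. stereo (g z)) sequentially))"

definition fatou_set :: "complex poly \<Rightarrow> complex option set" where
  "fatou_set p =
     {x. \<exists>U. openin riemann_sphere U \<and> x \<in> U \<and> iterates_normal_on (sphere_map p) U}"

definition fatou_components :: "complex poly \<Rightarrow> complex option set set" where
  "fatou_components p = connected_components_of (subtopology riemann_sphere (fatou_set p))"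

(* Chart around infinity: w = 1/z. *)
definition chart_inf :: "complex \<Rightarrow> complex option" where
  "chart_inf w = (if w = 0 then None else Some (1 / w))"

(* For G open in the sphere: holomorphy in both charts. *)
definition sphere_holomorphic_on :: "(complex option \<Rightarrow> complex) \<Rightarrow> complex option set \<Rightarrow> bool" where
  "sphere_holomorphic_on h G \<longleftrightarrow>
     (\<lambda>z. h (Some z)) holomorphic_on {z. Some z \<in> G} \<and>
     (\<lambda>w. h (chart_inf w)) holomorphic_on {w. chart_inf w \<in> G}"

(* The neutral fixed point is taken finite: for degree at least 2 infinity has multiplier 0.
   A holomorphic bijection between open sets has a holomorphic inverse, so h is a conformal
   isomorphism of G onto the unit disk, where the rotation acts. *)
definition siegel_disk :: "complex poly \<Rightarrow> complex option set \<Rightarrow> bool" where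
  "siegel_disk p G \<longleftrightarrow>
     G \<in> fatou_components p \<and>
     sphere_map p ` G = G \<and>
     (\<exists>w. Some w \<in> G \<and> poly p w = w \<and> norm (deriv (poly p) w) = 1) \<and>
     (\<exists>h c. sphere_holomorphic_on h G \<and> bij_betw h G (ball 0 1) \<and> norm c = 1 \<and>
        (\<forall>x\<in>G. h (sphere_map p x) = c * h x))"

definition periodic_point :: "('a \<Rightarrow> 'a) \<Rightarrow> 'a \<Rightarrow> bool" where
  "periodic_point F x \<longleftrightarrow> (\<exists>n\<ge>1. (F ^^ n) x = x)"

definition indecomposable_continuum :: "'a topology \<Rightarrow> bool" where
  "indecomposable_continuum X \<longleftrightarrow>
     compact_space X \<and> connected_space X \<and>
     \<not> (\<exists>A B. closedin X A \<and> connectedin X A \<and> A \<noteq> topspace X \<and>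
              closedin X B \<and> connectedin X B \<and> B \<noteq> topspace X \<and>
              topspace X = A \<union> B)"

end

theory Submission
  imports Defs "HOL-Analysis.Kronecker_Approximation_Theorem"
    "HOL-Computational_Algebra.Fundamental_Theorem_Algebra"
begin

text \<open>
  Let \<open>G\<close> be the Siegel disk, \<open>X\<close> its boundary and \<open>\<phi>\<close> the inverse of the linearising map: \<open>\<phi>\<close> maps
  the unit disc conformally onto \<open>G\<close> and carries the rotation by an angle \<open>\<alpha>\<close> to the polynomial. A
  polynomial of degree at least two has no iterate that is the identity on an open set, so \<open>\<alpha>\<close> is
  an irrational multiple of \<open>2\<pi>\<close>. The impression at the angle \<open>\<theta>\<close> is the set of all limits of
  \<open>\<phi>(z\<^sub>n)\<close> with \<open>z\<^sub>n\<close> tending to \<open>cis \<theta>\<close>. Impressions are continua, they cover \<open>X\<close>, and the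
  polynomial maps the impression at \<open>\<theta>\<close> onto the one at \<open>\<theta> + \<alpha>\<close>. A periodic point that lies in one
  impression therefore lies in the impressions at a dense set of angles, hence in all of them
  (\<open>periodic_in_impression\<close>). So unions of impressions are connected, and \<open>X\<close> is connected.

  The plane topology enters through the crosscut lemma (\<open>crosscut_sides\<close>). By the maximum principle
  the iterates are bounded on every bounded component of the complement of \<open>X\<close>, so \<open>X\<close> is also the
  boundary of the unbounded component \<open>U\<close>. Let \<open>L\<close> be a curve in the disc that joins two points of the circle
  and whose image lands at two points of a continuum \<open>Q \<subseteq> X\<close>. Then on one of the two open arcs cut off by \<open>L\<close>
  all impressions lie in \<open>Q\<close>: otherwise points of \<open>G\<close> on the two sides of \<open>L\<close> could be joined through
  \<open>U\<close>, avoiding \<open>Q \<union> \<phi>(L)\<close>; as they can also be joined inside \<open>G\<close> and the intersection of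
  \<open>Q \<union> \<phi>(L)\<close> with the complement of \<open>G\<close> is the connected set \<open>Q\<close>, Janiszewski's theorem would join
  them in \<open>G - \<phi>(L)\<close>, although \<open>L\<close> separates the disc. Curves that land exist at a dense set of
  angles. By rotation a single one suffices: the preimage of the segment from a point of \<open>G\<close> to a
  nearest boundary point has finite length (\<open>univalent_inverse_lands\<close>).

  The rest is combinatorics on the circle. First, the impressions over an arc longer than a
  half circle never fit into a proper subcontinuum of \<open>X\<close> (\<open>filled_arc_at_most_half\<close>): otherwise two
  such arcs, moved by the rotation, cover the circle and overlap around two opposite angles. The
  union of two impressions over the two overlaps is a continuum through the periodic point, and
  applying the crosscut lemma to it puts all impressions into one proper subcontinuum. Now let
  \<open>X = A \<union> B\<close> with proper subcontinua. The crosscut lemma and the half circle bound give two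
  complementary half circles over which the impressions lie in \<open>A\<close> and in \<open>B\<close>, respectively. If
  \<open>\<theta>\<close> is an accessible angle in the second one, then \<open>A\<close> together with the impression at \<open>\<theta>\<close> is
  all of \<open>X\<close>, since otherwise this continuum would contain the impressions over a longer arc; by a
  similar comparison, the impression is the same set for all these \<open>\<theta>\<close>. As the rotation is
  neither the identity nor a half turn, it takes some of these angles into the first half circle
  and keeps some in the second. Hence that set is mapped onto a subset of \<open>A\<close> which together with
  \<open>A\<close> gives \<open>X\<close>, so that \<open>A = X\<close> (\<open>not_decomposable\<close>).
\<close>

section \<open>Boundary landing for inverses of univalent maps\<close>

text \<open>Injectivity of the exponential of \<open>l\<close> means that the image of \<open>l\<close> is disjoint from its translates
  by \<open>2\<pi>\<i>\<close>, so the image contains no disc of radius larger than \<open>\<pi>\<close>; Bloch's theorem provides such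
  a disc as soon as the derivative is too large.\<close>
lemma univalent_log_deriv_bound:
  assumes hol: "l holomorphic_on ball z r" and inj: "inj_on (\<lambda>w. exp (l w)) (ball z r)" and "0 < r"
  shows "r * norm (deriv l z) \<le> 12 * pi"
proof (rule ccontr)
  assume "\<not> ?thesis"
  then have gt: "pi < r * norm (deriv l z) / 12" by simp
  obtain b where b: "ball b (r * norm (deriv l z) / 12) \<subseteq> l ` ball z r"
    using Bloch [OF hol \<open>0 < r\<close> order_refl] by blast
  have "b + \<i> * pi \<in> l ` ball z r" "b - \<i> * pi \<in> l ` ball z r"
    by (rule subsetD [OF b], use gt in \<open>simp add: dist_norm norm_mult\<close>)+
  then obtain u v where u: "u \<in> ball z r" "l u = b + \<i> * pi" and v: "v \<in> ball z r" "l v = b - \<i> * pi"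
    by (metis imageE)
  have "exp (l u) = exp (l v)"
    using u v by (simp add: exp_add exp_diff)
  then have "u = v"
    using inj_onD [OF inj] u v by blast
  with u v show False by simp
qed

text \<open>Integrate the bound on the derivative of the logarithm along a radius. Without injectivity a
  nonvanishing function may decay faster than any power of the distance to the circle.\<close>
lemma univalent_nonvanishing_lower_bound:
  assumes hol: "F holomorphic_on ball 0 1" and inj: "inj_on F (ball 0 1)"
    and nz: "\<And>z. z \<in> ball 0 1 \<Longrightarrow> F z \<noteq> 0" and z: "z \<in> ball 0 1"
  shows "norm (F 0) * (1 - norm z) powr (12 * pi) \<le> norm (F z)"
proof -
  obtain l where l: "l holomorphic_on ball 0 1" and el: "\<And>z. z \<in> ball 0 1 \<Longrightarrow> exp (l z) = F z"
    using holomorphic_logarithm_exists [of "ball 0 1" F 0] hol nz by auto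
  have bnd: "(1 - norm w) * norm (deriv l w) \<le> 12 * pi" if w: "w \<in> ball 0 1" for w
  proof (rule univalent_log_deriv_bound)
    have sub: "ball w (1 - norm w) \<subseteq> ball 0 1"
      by (simp add: ball_subset_ball_iff)
    show "l holomorphic_on ball w (1 - norm w)"
      using l sub holomorphic_on_subset by blast
    show "inj_on (\<lambda>u. exp (l u)) (ball w (1 - norm w))"
      using sub el inj by (auto simp: inj_on_def subset_iff)
    show "0 < 1 - norm w" using w by simp
  qed
  define a where "a = norm z"
  have a: "0 \<le> a" "a < 1" using z by (auto simp: a_def)
  have mem: "of_real t * z \<in> ball 0 1" if "0 \<le> t" "t \<le> 1" for t
    using that a mult_left_le_one_le [of a t] by (simp add: norm_mult a_def)
  have pos: "0 < 1 - t * a" if "0 \<le> t" "t \<le> 1" for t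
    using that a mult_left_le_one_le [of a t] by simp
  have cl: "continuous_on (ball 0 1) l"
    using l by (rule holomorphic_on_imp_continuous_on)
  have "norm (l (of_real 1 * z) - l (of_real 0 * z))
      \<le> - (12 * pi) * ln (1 - 1 * a) - - (12 * pi) * ln (1 - 0 * a)"
  proof (rule differentiable_bound_general [where f' = "\<lambda>t. z * deriv l (of_real t * z)"
        and \<phi>' = "\<lambda>t. 12 * pi * a / (1 - t * a)" and \<phi> = "\<lambda>t. - (12 * pi) * ln (1 - t * a)"
        and f = "\<lambda>t. l (of_real t * z)"])
    show "continuous_on {0..1} (\<lambda>t. l (of_real t * z))"
      by (rule continuous_on_compose2 [OF cl]) (use mem in \<open>auto intro!: continuous_intros\<close>)
    show "continuous_on {0..1} (\<lambda>t. - (12 * pi) * ln (1 - t * a))"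
      using pos by (force intro!: continuous_intros)
  next
    fix t :: real assume t: "0 < t" "t < 1"
    have "(l has_field_derivative deriv l (of_real t * z)) (at (of_real t * z))"
      using l mem [of t] t by (intro holomorphic_derivI) auto
    then have "((l \<circ> (\<lambda>t. of_real t * z)) has_vector_derivative z * deriv l (of_real t * z)) (at t)"
      by (intro field_vector_diff_chain_at) (auto intro!: derivative_eq_intros has_vector_derivative_real_field)
    then show "((\<lambda>t. l (of_real t * z)) has_vector_derivative z * deriv l (of_real t * z)) (at t)"
      by (simp add: o_def)
    show "((\<lambda>t. - (12 * pi) * ln (1 - t * a)) has_vector_derivative 12 * pi * a / (1 - t * a)) (at t)"
      unfolding has_real_derivative_iff_has_vector_derivative [symmetric]
      using pos [of t] t by (auto intro!: derivative_eq_intros)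
    have "(1 - t * a) * norm (deriv l (of_real t * z)) \<le> 12 * pi"
      using bnd [OF mem, of t] t by (simp add: norm_mult a_def)
    then have "norm (deriv l (of_real t * z)) \<le> 12 * pi / (1 - t * a)"
      using pos [of t] t by (simp add: field_simps)
    then have "a * norm (deriv l (of_real t * z)) \<le> a * (12 * pi / (1 - t * a))"
      using a by (intro mult_left_mono)
    then show "norm (z * deriv l (of_real t * z)) \<le> 12 * pi * a / (1 - t * a)"
      by (simp add: norm_mult a_def mult_ac)
  qed simp
  then have "norm (l z - l 0) \<le> - (12 * pi) * ln (1 - a)" by simp
  moreover have "\<bar>Re (l z - l 0)\<bar> \<le> norm (l z - l 0)" by (rule abs_Re_le_cmod)
  ultimately have "Re (l 0) + 12 * pi * ln (1 - a) \<le> Re (l z)" by simp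
  then have "exp (Re (l 0) + 12 * pi * ln (1 - a)) \<le> exp (Re (l z))" by simp
  moreover have "exp (Re (l 0)) = norm (F 0)" "exp (Re (l z)) = norm (F z)"
    using el [of 0] el [of z] z by (auto simp flip: norm_exp_eq_Re)
  ultimately show ?thesis
    using a by (simp add: exp_add powr_def a_def mult_ac)
qed

text \<open>Normalise with a Moebius transformation and apply the Schwarz lemma at the centre.\<close>
lemma Schwarz_Pick_deriv:
  assumes hol: "h holomorphic_on ball w r" and "0 < r" and im: "h ` ball w r \<subseteq> ball 0 1"
  shows "r * norm (deriv h w) \<le> 2 * (1 - norm (h w))"
proof -
  define k where "k = h w"
  have k: "norm k < 1" using im \<open>0 < r\<close> by (auto simp: k_def image_subset_iff)
  define g where "g u = Moebius_function 0 k (h (w + of_real r * u))" for u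
  have memr: "w + of_real r * u \<in> ball w r" if "norm u < 1" for u
    using that \<open>0 < r\<close> by (simp add: dist_norm norm_mult)
  have h1: "(\<lambda>u. h (w + of_real r * u)) holomorphic_on ball 0 1"
    by (rule holomorphic_on_compose_gen [OF _ hol, unfolded o_def])
       (use memr in \<open>auto intro!: holomorphic_intros\<close>)
  have g: "g holomorphic_on ball 0 1"
    unfolding g_def
    by (rule holomorphic_on_compose_gen [OF h1 Moebius_function_holomorphic [OF k], unfolded o_def])
       (use memr im in \<open>auto simp: image_subset_iff\<close>)
  have dg: "norm (deriv g 0) \<le> 1"
  proof (rule Schwarz_Lemma(2) [OF g, of 0])
    show "g 0 = 0" by (simp add: g_def k_def Moebius_function_eq_zero)
    show "norm (g z) < 1" if "norm z < 1" for z
      unfolding g_def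
      by (rule Moebius_function_norm_lt_1 [OF k]) (use memr [OF that] im in \<open>auto simp: image_subset_iff\<close>)
  qed auto
  have dh: "(h has_field_derivative deriv h w) (at w)"
    using hol \<open>0 < r\<close> by (intro holomorphic_derivI) auto
  have "((\<lambda>u. h (w + of_real r * u)) has_field_derivative deriv h w * r) (at 0)"
    by (rule DERIV_chain2 [where f = h]) (use dh in \<open>auto intro!: derivative_eq_intros\<close>)
  have kk: "1 - cnj k * k = of_real (1 - (norm k)\<^sup>2)"
    using complex_norm_square [of k] by (simp add: mult.commute)
  have lt: "(norm k)\<^sup>2 < 1" using k by (simp add: power_less_one_iff)
  have nz: "1 - cnj k * k \<noteq> 0"
    unfolding kk using lt by (simp del: of_real_diff)
  have "(Moebius_function 0 k has_field_derivative 1 / (1 - cnj k * k)) (at k)"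
    unfolding Moebius_function_def
    using nz by (auto intro!: derivative_eq_intros simp: divide_simps)
  then have "(g has_field_derivative 1 / (1 - cnj k * k) * (deriv h w * r)) (at 0)"
    unfolding g_def
    by (intro DERIV_chain2 [where f = "Moebius_function 0 k"]) (use \<open>(_ has_field_derivative deriv h w * r) (at 0)\<close> in \<open>auto simp: k_def\<close>)
  then have "deriv g 0 = deriv h w * r / (1 - cnj k * k)"
    by (simp add: DERIV_imp_deriv)
  then have "norm (deriv g 0) = norm (deriv h w) * r / (1 - (norm k)\<^sup>2)"
    unfolding kk using \<open>0 < r\<close> lt by (simp add: norm_divide norm_mult del: of_real_diff)
  with dg lt have "norm (deriv h w) * r \<le> 1 - (norm k)\<^sup>2" by (simp add: field_simps)
  also have "\<dots> = (1 + norm k) * (1 - norm k)" by (simp add: power2_eq_square algebra_simps)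
  also have "\<dots> \<le> 2 * (1 - norm k)" using k by (intro mult_right_mono) auto
  finally show ?thesis by (simp add: k_def mult.commute)
qed

text \<open>The point of the segment at distance \<open>\<tau>\<close> from the boundary point \<open>a\<close> is the centre of a disc of
  radius \<open>\<tau>\<close> inside \<open>G\<close>. The power lower bound for \<open>\<phi> - a\<close> gives \<open>1 - |h| \<le> C \<tau>\<^sup>\<beta>\<close> there for some \<open>\<beta> > 0\<close>, and
  the Schwarz-Pick inequality turns this into \<open>|h'| \<le> 2 C \<tau>\<^sup>\<beta> / \<tau>\<close>, which is integrable at zero. So
  the image of the segment has finite length.\<close>
lemma univalent_inverse_lands:
  assumes holphi: "\<phi> holomorphic_on ball 0 1" and holh: "h holomorphic_on G" and "open G"
    and h\<phi>: "\<And>z. z \<in> ball 0 1 \<Longrightarrow> \<phi> z \<in> G \<and> h (\<phi> z) = z"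
    and \<phi>h: "\<And>w. w \<in> G \<Longrightarrow> h w \<in> ball 0 1 \<and> \<phi> (h w) = w"
    and "0 < s" and ball: "ball w s \<subseteq> G" and a: "a \<notin> G" "dist w a = s"
  shows "\<exists>\<zeta>. norm \<zeta> = 1 \<and> ((\<lambda>t. h (a + of_real t * (w - a))) \<longlongrightarrow> \<zeta>) (at_right 0)"
proof -
  (* The reciprocal of the exponent in the lower bound for univalent functions. *)
  define \<beta> where "\<beta> = 1 / (12 * pi)"
  have \<beta>: "0 < \<beta>" by (simp add: \<beta>_def)
  define \<sigma> where "\<sigma> t = a + of_real t * (w - a)" for t
  have na: "norm (w - a) = s" using a by (simp add: dist_norm)
  have sub: "ball (\<sigma> t) (t * s) \<subseteq> ball w s" if "0 < t" "t \<le> 1" for t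
  proof -
    have "w - \<sigma> t = of_real (1 - t) * (w - a)" by (simp add: \<sigma>_def algebra_simps)
    then have "dist w (\<sigma> t) = (1 - t) * s" using that na by (simp add: dist_norm norm_mult del: of_real_diff)
    then show ?thesis by (simp add: ball_subset_ball_iff dist_commute algebra_simps)
  qed
  have \<sigma>G: "\<sigma> t \<in> G" if "0 < t" "t \<le> 1" for t
    using sub [OF that] ball that \<open>0 < s\<close> centre_in_ball by (metis mult_pos_pos subsetD)
  define F where "F z = \<phi> z - a" for z
  have F0: "0 < norm (F 0)" using h\<phi> [of 0] a by (auto simp: F_def)
  define C where "C = (s / norm (F 0)) powr \<beta>"
  have C: "0 < C" using \<open>0 < s\<close> F0 by (simp add: C_def)
  have est: "1 - norm (h (\<sigma> t)) \<le> C * t powr \<beta>" if t: "0 < t" "t \<le> 1" for t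
  proof -
    have z: "h (\<sigma> t) \<in> ball 0 1" "\<phi> (h (\<sigma> t)) = \<sigma> t" using \<phi>h \<sigma>G t by auto
    have "norm (F 0) * (1 - norm (h (\<sigma> t))) powr (12 * pi) \<le> norm (F (h (\<sigma> t)))"
    proof (rule univalent_nonvanishing_lower_bound)
      show "F holomorphic_on ball 0 1" unfolding F_def by (intro holomorphic_intros holphi)
      show "inj_on F (ball 0 1)" using h\<phi> by (auto simp: F_def inj_on_def) metis
      show "F z \<noteq> 0" if "z \<in> ball 0 1" for z using h\<phi> [OF that] a by (auto simp: F_def)
    qed (use z in auto)
    also have "norm (F (h (\<sigma> t))) = t * s"
      using z t na by (simp add: F_def \<sigma>_def norm_mult)
    finally have "(1 - norm (h (\<sigma> t))) powr (12 * pi) \<le> (s / norm (F 0)) * t"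
      using F0 by (simp add: field_simps)
    then have "((1 - norm (h (\<sigma> t))) powr (12 * pi)) powr \<beta> \<le> ((s / norm (F 0)) * t) powr \<beta>"
      using \<beta> by (intro powr_mono2) auto
    then show ?thesis
      using z t \<open>0 < s\<close> F0 powr_mult [of "s / norm (F 0)" t \<beta>] by (simp add: powr_powr C_def \<beta>_def)
  qed
  have der: "s * norm (deriv h (\<sigma> t)) \<le> 2 * C * t powr (\<beta> - 1)" if t: "0 < t" "t \<le> 1" for t
  proof -
    have "t * s * norm (deriv h (\<sigma> t)) \<le> 2 * (1 - norm (h (\<sigma> t)))"
    proof (rule Schwarz_Pick_deriv)
      show "h holomorphic_on ball (\<sigma> t) (t * s)"
        using holh sub [OF t] ball holomorphic_on_subset by blast
      show "h ` ball (\<sigma> t) (t * s) \<subseteq> ball 0 1" using \<phi>h sub [OF t] ball by blast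
    qed (use t \<open>0 < s\<close> in simp)
    also have "\<dots> \<le> 2 * (C * t powr \<beta>)" using est [OF t] by simp
    finally show ?thesis using t by (simp add: powr_diff field_simps)
  qed
  define D where "D = 2 * C / \<beta>"
  have D: "0 < D" using C \<beta> by (simp add: D_def)
  define v where "v t = h (\<sigma> t)" for t
  have len: "norm (v y - v x) \<le> D * y powr \<beta> - D * x powr \<beta>" if xy: "0 < x" "x < y" "y \<le> 1" for x y
  proof (rule differentiable_bound_general [where f' = "\<lambda>t. (w - a) * deriv h (\<sigma> t)"
        and \<phi>' = "\<lambda>t. 2 * C * t powr (\<beta> - 1)" and \<phi> = "\<lambda>t. D * t powr \<beta>"])
    show "continuous_on {x..y} v"
      unfolding v_def
      by (rule continuous_on_compose2 [OF holomorphic_on_imp_continuous_on [OF holh]])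
         (use \<sigma>G xy in \<open>auto simp: \<sigma>_def intro!: continuous_intros\<close>)
    show "continuous_on {x..y} (\<lambda>t. D * t powr \<beta>)"
      using xy by (auto intro!: continuous_intros)
  next
    fix t assume t: "x < t" "t < y"
    have "(h has_field_derivative deriv h (\<sigma> t)) (at (\<sigma> t))"
      using holh \<open>open G\<close> \<sigma>G [of t] t xy by (intro holomorphic_derivI) auto
    then have "((h \<circ> \<sigma>) has_vector_derivative (w - a) * deriv h (\<sigma> t)) (at t)"
      unfolding \<sigma>_def
      by (intro field_vector_diff_chain_at) (auto intro!: derivative_eq_intros has_vector_derivative_real_field)
    then show "(v has_vector_derivative (w - a) * deriv h (\<sigma> t)) (at t)"
      by (simp add: o_def v_def [abs_def])
    show "((\<lambda>t. D * t powr \<beta>) has_vector_derivative 2 * C * t powr (\<beta> - 1)) (at t)"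
      unfolding has_real_derivative_iff_has_vector_derivative [symmetric]
      using t xy \<beta> by (auto intro!: derivative_eq_intros simp: D_def)
    show "norm ((w - a) * deriv h (\<sigma> t)) \<le> 2 * C * t powr (\<beta> - 1)"
      using der [of t] t xy na by (simp add: norm_mult)
  qed (use xy in auto)
  have len': "norm (v y - v x) \<le> D * y powr \<beta>" if "0 < x" "x \<le> y" "y \<le> 1" for x y
  proof (cases "x = y")
    case False
    have "0 \<le> D * x powr \<beta>" using D by simp
    with len [of x y] that False show ?thesis by linarith
  qed (use D in auto)
  have pow0: "((\<lambda>t. D * t powr \<beta>) \<longlongrightarrow> 0) (at_right 0)"
  proof -
    have "((\<lambda>t::real. t powr \<beta>) \<longlongrightarrow> 0) (at_right 0)"
      using \<beta> by (intro tendsto_eq_intros tendsto_powr2 eventually_at_right_less) (auto simp: eventually_at_right_field intro: exI[of _ 1])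
    then show ?thesis by (auto intro: tendsto_mult_right_zero)
  qed
  define x where "x n = 1 / real (Suc n)" for n
  have x: "0 < x n" "x n \<le> 1" for n by (auto simp: x_def field_simps)
  have xlim: "x \<longlonglongrightarrow> 0" using LIMSEQ_inverse_real_of_nat by (simp add: x_def [abs_def] inverse_eq_divide)
  have xr: "filterlim x (at_right 0) sequentially"
    using xlim x by (auto simp: filterlim_at less_imp_neq [symmetric] intro!: always_eventually)
  have Dx: "(\<lambda>n. D * x n powr \<beta>) \<longlonglongrightarrow> 0"
    by (rule filterlim_compose [OF pow0 xr])
  have "Cauchy (\<lambda>n. v (x n))"
  proof (rule CauchyI')
    fix e :: real assume "0 < e"
    then obtain M where M: "\<And>n. n \<ge> M \<Longrightarrow> D * x n powr \<beta> < e"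
      using order_tendstoD(2) [OF Dx] by (auto simp: eventually_sequentially)
    show "\<exists>M. \<forall>m\<ge>M. \<forall>n>m. dist (v (x m)) (v (x n)) < e"
    proof (intro exI allI impI)
      fix m n assume "m \<ge> M" "m < n"
      have "x n \<le> x m" using \<open>m < n\<close> by (simp add: x_def field_simps)
      then have "norm (v (x m) - v (x n)) \<le> D * x m powr \<beta>" using len' x by blast
      with M [OF \<open>m \<ge> M\<close>] show "dist (v (x m)) (v (x n)) < e" by (simp add: dist_norm)
    qed
  qed
  then obtain \<zeta> where \<zeta>: "(\<lambda>n. v (x n)) \<longlonglongrightarrow> \<zeta>" by (auto simp: Cauchy_convergent_iff convergent_def)
  have vz: "norm (v t - \<zeta>) \<le> D * t powr \<beta>" if t: "0 < t" "t \<le> 1" for t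
  proof (rule tendsto_upperbound)
    show "(\<lambda>n. norm (v t - v (x n))) \<longlonglongrightarrow> norm (v t - \<zeta>)" by (intro tendsto_intros \<zeta>)
    have "\<forall>\<^sub>F n in sequentially. x n < t" using order_tendstoD(2) [OF xlim] t by auto
    then show "\<forall>\<^sub>F n in sequentially. norm (v t - v (x n)) \<le> D * t powr \<beta>"
      by eventually_elim (use len' x t in auto)
  qed auto
  have ev: "\<forall>\<^sub>F t in at_right 0. 0 < t \<and> t \<le> (1::real)"
    by (auto simp: eventually_at_right_field intro: exI[of _ 1])
  have "((\<lambda>t. v t - \<zeta>) \<longlongrightarrow> 0) (at_right 0)"
    by (rule Lim_null_comparison [OF _ pow0]) (use ev vz in \<open>auto elim!: eventually_mono\<close>)
  then have lim: "(v \<longlongrightarrow> \<zeta>) (at_right 0)" by (simp add: LIM_zero_iff)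
  have "norm \<zeta> = 1"
  proof (rule antisym)
    show "norm \<zeta> \<le> 1"
      by (rule tendsto_upperbound [OF tendsto_norm [OF \<zeta>]])
         (use \<phi>h \<sigma>G x in \<open>auto simp: v_def less_imp_le intro!: always_eventually\<close>)
    have "((\<lambda>t. C * t powr \<beta>) \<longlongrightarrow> 0) (at_right 0)"
      using tendsto_mult_left [OF pow0, of "C / D"] D by simp
    then have "(\<lambda>n. C * x n powr \<beta>) \<longlonglongrightarrow> 0" by (rule filterlim_compose [OF _ xr])
    moreover have "(\<lambda>n. 1 - norm (v (x n))) \<longlonglongrightarrow> 1 - norm \<zeta>" by (intro tendsto_intros \<zeta>)
    ultimately have "1 - norm \<zeta> \<le> 0"
      by (rule tendsto_le [OF sequentially_bot]) (use est x in \<open>auto simp: v_def intro!: always_eventually\<close>)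
    then show "1 \<le> norm \<zeta>" by simp
  qed
  with lim show ?thesis unfolding v_def \<sigma>_def by blast
qed

section \<open>Crosscuts of the unit disc\<close>

lemma winding_number_part_circlepath_centre:
  assumes "s < t"
  shows "winding_number (part_circlepath 0 1 s t) 0 = (t - s) / (2 * pi)"
proof -
  have "0 \<notin> path_image (part_circlepath 0 1 s t)"
    using path_image_part_circlepath_subset [of s t 1 0] assms by auto
  then have "winding_number (part_circlepath 0 1 s t) 0
      = 1 / (2 * pi * \<i>) * contour_integral (part_circlepath 0 1 s t) (\<lambda>w. 1 / (w - 0))"
    by (simp add: winding_number_valid_path)
  also have "contour_integral (part_circlepath 0 1 s t) (\<lambda>w. 1 / (w - 0))
      = integral {s..t} (\<lambda>x. 1 / (0 + of_real 1 * cis x - 0) * of_real 1 * \<i> * cis x)"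
    using assms by (rule contour_integral_part_circlepath_eq)
  also have "\<dots> = integral {s..t} (\<lambda>x. \<i>)" by (simp add: field_simps)
  also have "\<dots> = \<i> * (t - s)" using assms by (simp add: scaleR_conv_of_real)
  finally show ?thesis by simp
qed

text \<open>Close the curve by each of the two arcs of the circle. The loop closed by one arc has winding
  number zero near interior points of the other arc, whereas the two winding numbers
  add up to one everywhere in the disc off the curve.\<close>
lemma crosscut_separates_disc:
  assumes g: "path g" "pathstart g = cis s" "pathfinish g = cis t"
    and gD: "\<And>x. \<lbrakk>0 < x; x < 1\<rbrakk> \<Longrightarrow> g x \<in> ball 0 1"
    and a: "s < a" "a < t" and b: "t < b" "b < s + 2 * pi"
  shows "\<exists>e>0. \<forall>z1 z2 C. z1 \<in> ball 0 1 \<inter> ball (cis a) e \<longrightarrow> z2 \<in> ball 0 1 \<inter> ball (cis b) e \<longrightarrow>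
      connected C \<longrightarrow> C \<subseteq> ball 0 1 - path_image g \<longrightarrow> z1 \<in> C \<longrightarrow> z2 \<notin> C"
proof -
  define J1 where "J1 = part_circlepath 0 1 s t"
  define J2 where "J2 = part_circlepath 0 1 t (s + 2 * pi)"
  have J: "path J1" "path J2" "pathstart J1 = cis s" "pathfinish J1 = cis t"
      "pathstart J2 = cis t" "pathfinish J2 = cis s"
    using exp_two_pi_i'
    by (auto simp: J1_def J2_def exp_add distrib_left cis_conv_exp mult.commute [of 2])
  have imJ1: "path_image J1 = cis ` {s..t}" and imJ2: "path_image J2 = cis ` {t..s + 2 * pi}"
    using a b by (auto simp: J1_def J2_def path_image_part_circlepath' closed_segment_eq_real_ivl)
  define \<Gamma>1 where "\<Gamma>1 = g +++ J2"
  define \<Gamma>2 where "\<Gamma>2 = J1 +++ reversepath g"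
  have \<Gamma>: "path \<Gamma>1" "path \<Gamma>2" "pathfinish \<Gamma>1 = pathstart \<Gamma>1" "pathfinish \<Gamma>2 = pathstart \<Gamma>2"
    using g J by (auto simp: \<Gamma>1_def \<Gamma>2_def)
  have im: "path_image \<Gamma>1 = path_image g \<union> path_image J2" "path_image \<Gamma>2 = path_image J1 \<union> path_image g"
    using g J by (auto simp: \<Gamma>1_def \<Gamma>2_def path_image_join)
  have img: "x \<in> ball 0 1 \<or> x = cis s \<or> x = cis t" if "x \<in> path_image g" for x
  proof -
    from that obtain u where u: "0 \<le> u" "u \<le> 1" "x = g u" by (auto simp: path_image_def)
    then show ?thesis
      using gD [of u] g(2,3) by (cases "u = 0"; cases "u = 1") (auto simp: pathstart_def pathfinish_def)
  qed
  have cis_ne: "cis x \<noteq> cis y" if "x < y" "y < x + 2 * pi" for x y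
  proof
    assume "cis x = cis y"
    then have "cis (y - x) = 1" by (simp flip: cis_divide)
    then have "cos (y - x) = 1" by (simp add: complex_eq_iff)
    then obtain n :: int where n: "y - x = n * (2 * pi)" by (auto simp: cos_one_2pi_int mult.assoc)
    have "0 * (2 * pi) < of_int n * (2 * pi)" "of_int n * (2 * pi) < 1 * (2 * pi)" using n that by linarith+
    then have "0 < real_of_int n" "real_of_int n < 1"
      by (simp_all only: mult_less_cancel_right_pos [of "2 * pi"] pi_gt_zero zero_less_mult_iff zero_less_numeral simp_thms)
    then show False by simp
  qed
  have in_cball: "path_image \<Gamma>1 \<subseteq> cball 0 1" "path_image \<Gamma>2 \<subseteq> cball 0 1"
    using img unfolding im imJ1 imJ2 by fastforce+
  have aux: "\<exists>e>0. \<forall>z \<in> ball (cis x) e. winding_number \<Gamma> z = 0"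
    if \<Gamma>: "path \<Gamma>" "pathfinish \<Gamma> = pathstart \<Gamma>" "path_image \<Gamma> \<subseteq> cball 0 1" "cis x \<notin> path_image \<Gamma>" for \<Gamma> x
  proof -
    have "open (- path_image \<Gamma>)" using \<Gamma> by (simp add: closed_path_image open_Compl)
    then obtain e where e: "e > 0" "ball (cis x) e \<subseteq> - path_image \<Gamma>"
      using \<Gamma>(4) open_contains_ball by (metis ComplI)
    (* A point just outside the closed disc, where the winding number vanishes. *)
    define y where "y = of_real (1 + e / 2) * cis x"
    have "dist (cis x) y = norm (of_real (e / 2) * cis x)"
      by (simp add: y_def dist_norm algebra_simps norm_minus_commute norm_mult)
    then have y: "y \<in> ball (cis x) e" "y \<notin> cball 0 1"
      using e by (auto simp: y_def norm_mult simp del: of_real_add)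
    have "winding_number \<Gamma> y = 0"
      by (rule winding_number_zero_outside [OF \<Gamma>(1) convex_cball \<Gamma>(2) y(2) \<Gamma>(3)])
    moreover have "winding_number \<Gamma> z = winding_number \<Gamma> y" if "z \<in> ball (cis x) e" for z
      by (rule winding_number_eq [OF \<Gamma>(1,2) that y(1) connected_ball]) (use e in blast)
    ultimately show ?thesis using e by metis
  qed
  have "cis a \<notin> path_image \<Gamma>1"
  proof
    assume "cis a \<in> path_image \<Gamma>1"
    then have "cis a = cis s \<or> (\<exists>x\<in>{t..s+2*pi}. cis a = cis x)"
      using img [of "cis a"] a b unfolding im imJ2 by force
    then show False using cis_ne [of a] cis_ne [of s a] a b by force
  qed
  then obtain e1 where e1: "e1 > 0" "\<And>z. z \<in> ball (cis a) e1 \<Longrightarrow> winding_number \<Gamma>1 z = 0"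
    using aux [OF \<Gamma>(1,3) in_cball(1)] by metis
  have "cis b \<notin> path_image \<Gamma>2"
  proof
    assume "cis b \<in> path_image \<Gamma>2"
    then have "(\<exists>x\<in>{s..t}. cis b = cis x)"
      using img [of "cis b"] a b unfolding im imJ1 by force
    then obtain x where "s \<le> x" "x \<le> t" "cis b = cis x" by auto
    then show False using cis_ne [of x b] a b by simp
  qed
  then obtain e2 where e2: "e2 > 0" "\<And>z. z \<in> ball (cis b) e2 \<Longrightarrow> winding_number \<Gamma>2 z = 0"
    using aux [OF \<Gamma>(2,4) in_cball(2)] by metis
  show ?thesis
  proof (intro exI conjI allI impI notI)
    show "0 < min e1 e2" using e1 e2 by simp
    fix z1 z2 C
    assume z1: "z1 \<in> ball 0 1 \<inter> ball (cis a) (min e1 e2)" and z2: "z2 \<in> ball 0 1 \<inter> ball (cis b) (min e1 e2)"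
      and C: "connected C" "C \<subseteq> ball 0 1 - path_image g" "z1 \<in> C" "z2 \<in> C"
    have J_sphere: "path_image J1 \<subseteq> sphere 0 1" "path_image J2 \<subseteq> sphere 0 1"
      by (auto simp: imJ1 imJ2)
    then have CJ: "C \<inter> path_image J1 = {}" "C \<inter> path_image J2 = {}"
      using C(2) by (fastforce simp: subset_iff)+
    have C\<Gamma>: "C \<inter> path_image \<Gamma>1 = {}" using C(2) CJ unfolding im by blast
    have "winding_number \<Gamma>1 z2 = winding_number \<Gamma>1 z1"
      using winding_number_eq [OF \<Gamma>(1,3) C(4,3,1) C\<Gamma>] .
    moreover have "winding_number \<Gamma>1 z1 = 0" "winding_number \<Gamma>2 z2 = 0" using e1 e2 z1 z2 by auto
    moreover have "winding_number \<Gamma>1 z2 = winding_number g z2 + winding_number J2 z2"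
      unfolding \<Gamma>1_def by (rule winding_number_join) (use g J C CJ in auto)
    moreover have "winding_number \<Gamma>2 z2 = winding_number J1 z2 + winding_number (reversepath g) z2"
      unfolding \<Gamma>2_def by (rule winding_number_join) (use g J C CJ in auto)
    moreover have "winding_number (reversepath g) z2 = - winding_number g z2"
      by (rule winding_number_reversepath) (use g C in auto)
    moreover have "winding_number (J1 +++ J2) z2 = winding_number J1 z2 + winding_number J2 z2"
      by (rule winding_number_join) (use J C CJ in auto)
    moreover have "winding_number (J1 +++ J2) z2 = winding_number (J1 +++ J2) 0"
      by (rule winding_number_eq [where S = "ball 0 1"])
         (use J z2 J_sphere in \<open>auto simp: path_image_join\<close>)
    moreover have "winding_number (J1 +++ J2) 0 = winding_number J1 0 + winding_number J2 0"
      by (rule winding_number_join) (use J J_sphere in auto)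
    moreover have "winding_number J1 0 + winding_number J2 0 = 1"
      using a b by (simp add: J1_def J2_def winding_number_part_circlepath_centre flip: add_divide_distrib)
    ultimately show False by simp
  qed
qed

section \<open>Impressions of a domain carrying an irrational rotation\<close>

text \<open>Kronecker's approximation theorem, rescaled from the unit interval to angles.\<close>
lemma irrational_rotation_dense:
  fixes \<alpha> \<theta> s t :: real
  assumes "\<alpha> / (2 * pi) \<notin> \<rat>" "s < t"
  obtains n :: nat and k :: int where "s < \<theta> + n * \<alpha> + 2 * pi * k" "\<theta> + n * \<alpha> + 2 * pi * k < t"
proof -
  define e where "e = (t - s) / (4 * pi)"
  have "e > 0" using assms by (simp add: e_def)
  then obtain h k :: int where k: "k > 0"
    "\<bar>of_int k * (\<alpha> / (2 * pi)) - of_int h - ((s + t) / 2 - \<theta>) / (2 * pi)\<bar> < e"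
    using sequence_of_fractional_parts_is_dense [OF assms(1)] by metis
  (* The deviation, measured in turns, from the middle of the target interval. *)
  define d where "d = of_int k * (\<alpha> / (2 * pi)) - of_int h - ((s + t) / 2 - \<theta>) / (2 * pi)"
  have "2 * pi * e = (t - s) / 2" by (simp add: e_def)
  moreover have "2 * pi * \<bar>d\<bar> < 2 * pi * e" using k by (simp add: d_def)
  ultimately have "2 * pi * \<bar>d\<bar> < (t - s) / 2" by linarith
  then have "\<bar>2 * pi * d\<bar> < (t - s) / 2" by (simp add: abs_mult)
  moreover have "2 * pi * d = \<theta> + of_int k * \<alpha> - 2 * pi * of_int h - (s + t) / 2"
    by (simp add: d_def field_simps)
  ultimately have "\<bar>\<theta> + of_int k * \<alpha> - 2 * pi * of_int h - (s + t) / 2\<bar> < (t - s) / 2" by simp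
  then have "s < \<theta> + of_int k * \<alpha> - 2 * pi * of_int h" "\<theta> + of_int k * \<alpha> - 2 * pi * of_int h < t"
    by (simp_all add: abs_less_iff field_simps)
  then show ?thesis
    using k(1) by (intro that [of "nat k" "- h"]) auto
qed

lemma unit_complex_eq_cis:
  assumes "norm z = 1" obtains \<theta> where "z = cis \<theta>"
  using rcis_cmod_Arg [of z] assms that [of "Arg z"] by (simp add: rcis_def)

text \<open>The planar data that the topological argument needs. The set \<open>U\<close> will be the unbounded component
  of the complement of the boundary.\<close>
locale rotation_domain =
  fixes F \<phi> h :: "complex \<Rightarrow> complex" and G U :: "complex set" and \<alpha> :: real
  assumes contF: "continuous_on UNIV F"
    and openG: "open G" and boundedG: "bounded G"
    and hol_phi: "\<phi> holomorphic_on ball 0 1" and hol_h: "h holomorphic_on G"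
    and phi: "z \<in> ball 0 1 \<Longrightarrow> \<phi> z \<in> G \<and> h (\<phi> z) = z"
    and h: "w \<in> G \<Longrightarrow> h w \<in> ball 0 1 \<and> \<phi> (h w) = w"
    and semiconj: "z \<in> ball 0 1 \<Longrightarrow> \<phi> (cis \<alpha> * z) = F (\<phi> z)"
    and irrational: "\<alpha> / (2 * pi) \<notin> \<rat>"
    and connU: "connected U" and U_disjoint: "U \<inter> closure G = {}" and U_closure: "frontier G \<subseteq> closure U"
begin

abbreviation X :: "complex set" where "X \<equiv> frontier G"

text \<open>The impression of the prime end at \<open>cis \<theta>\<close>. The index by real angles instead of points of the circle
  makes it easy to speak of arcs; the radii are \<open>1 / Suc n\<close> so that it is a nested intersection of a sequence of
  continua.\<close>
definition impression :: "real \<Rightarrow> complex set" where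
  "impression \<theta> = (\<Inter>n. closure (\<phi> ` (ball 0 1 \<inter> ball (cis \<theta>) (1 / real (Suc n)))))"

lemma X_disjoint: "X \<inter> G = {}"
  using openG by (simp add: frontier_disjoint_eq)

lemma cont_phi: "continuous_on (ball 0 1) \<phi>"
  using hol_phi by (rule holomorphic_on_imp_continuous_on)

lemma isCont_phi: "z \<in> ball 0 1 \<Longrightarrow> isCont \<phi> z"
  using cont_phi continuous_on_eq_continuous_at [OF open_ball] by blast

lemma isCont_h: "w \<in> G \<Longrightarrow> isCont h w"
  using holomorphic_on_imp_continuous_on [OF hol_h] continuous_on_eq_continuous_at [OF openG] by blast

lemma compact_X: "compact X"
  using boundedG by (simp add: compact_frontier_bounded)

lemma closure_G: "closure G = G \<union> X"
  by (simp add: closure_Un_frontier)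

lemma impression_subset_closure: "impression \<theta> \<subseteq> closure (\<phi> ` (ball 0 1 \<inter> ball (cis \<theta>) e))" if e: "e > 0"
proof -
  obtain n where "1 / real (Suc n) < e" using e by (rule nat_approx_posE)
  then have "ball (cis \<theta>) (1 / real (Suc n)) \<subseteq> ball (cis \<theta>) e" by (simp add: subset_ball)
  then have "closure (\<phi> ` (ball 0 1 \<inter> ball (cis \<theta>) (1 / real (Suc n)))) \<subseteq> closure (\<phi> ` (ball 0 1 \<inter> ball (cis \<theta>) e))"
    by (intro closure_mono image_mono) auto
  then show ?thesis unfolding impression_def by blast
qed

lemma in_impression_iff:
  "x \<in> impression \<theta> \<longleftrightarrow> (\<forall>e>0. x \<in> closure (\<phi> ` (ball 0 1 \<inter> ball (cis \<theta>) e)))"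
  using impression_subset_closure by (auto simp: impression_def)

lemma impression_iff_sequence:
  "x \<in> impression \<theta> \<longleftrightarrow> (\<exists>z. (\<forall>n. z n \<in> ball 0 1) \<and> z \<longlonglongrightarrow> cis \<theta> \<and> (\<lambda>n. \<phi> (z n)) \<longlonglongrightarrow> x)"
proof
  assume x: "x \<in> impression \<theta>"
  have "\<exists>z. z \<in> ball 0 1 \<and> dist (cis \<theta>) z < 1 / real (Suc n) \<and> dist (\<phi> z) x < 1 / real (Suc n)" for n
  proof -
    have "x \<in> closure (\<phi> ` (ball 0 1 \<inter> ball (cis \<theta>) (1 / real (Suc n))))"
      using x unfolding impression_def by blast
    then show ?thesis
      unfolding closure_approachable by (elim allE [of _ "1 / real (Suc n)"]) auto
  qed
  then obtain z where z: "\<And>n. z n \<in> ball 0 1" "\<And>n. dist (cis \<theta>) (z n) < 1 / real (Suc n)"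
      "\<And>n. dist (\<phi> (z n)) x < 1 / real (Suc n)" by metis
  have inv: "(\<lambda>n. 1 / real (Suc n)) \<longlonglongrightarrow> 0"
    using LIMSEQ_inverse_real_of_nat by (simp add: inverse_eq_divide)
  have "z \<longlonglongrightarrow> cis \<theta>"
    by (rule metric_tendsto_imp_tendsto [OF inv]) (use z in \<open>auto simp: dist_commute less_imp_le intro!: always_eventually\<close>)
  moreover have "(\<lambda>n. \<phi> (z n)) \<longlonglongrightarrow> x"
    by (rule metric_tendsto_imp_tendsto [OF inv]) (use z in \<open>auto simp: less_imp_le intro!: always_eventually\<close>)
  ultimately show "\<exists>z. (\<forall>n. z n \<in> ball 0 1) \<and> z \<longlonglongrightarrow> cis \<theta> \<and> (\<lambda>n. \<phi> (z n)) \<longlonglongrightarrow> x"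
    using z by blast
next
  assume "\<exists>z. (\<forall>n. z n \<in> ball 0 1) \<and> z \<longlonglongrightarrow> cis \<theta> \<and> (\<lambda>n. \<phi> (z n)) \<longlonglongrightarrow> x"
  then obtain z where z: "\<And>n. z n \<in> ball 0 1" "z \<longlonglongrightarrow> cis \<theta>" "(\<lambda>n. \<phi> (z n)) \<longlonglongrightarrow> x" by blast
  show "x \<in> impression \<theta>"
    unfolding in_impression_iff
  proof (intro allI impI)
    fix e :: real assume "e > 0"
    have "\<forall>\<^sub>F n in sequentially. z n \<in> ball (cis \<theta>) e"
      using tendstoD [OF z(2) \<open>e > 0\<close>] by (simp add: dist_commute)
    then have "\<forall>\<^sub>F n in sequentially. \<phi> (z n) \<in> closure (\<phi> ` (ball 0 1 \<inter> ball (cis \<theta>) e))"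
      by eventually_elim (use z(1) in \<open>auto intro!: subsetD [OF closure_subset]\<close>)
    then show "x \<in> closure (\<phi> ` (ball 0 1 \<inter> ball (cis \<theta>) e))"
      by (rule Lim_in_closed_set [OF closed_closure]) (use z in auto)
  qed
qed

lemma impression_cis: "cis \<theta> = cis \<theta>' \<Longrightarrow> impression \<theta> = impression \<theta>'"
  by (simp add: impression_def)

lemma cis_shift: "cis (\<theta> + 2 * pi * of_int k) = cis \<theta>"
  by (simp flip: cis_mult)

lemma closed_impression: "closed (impression \<theta>)"
  by (auto simp: impression_def)

text \<open>A limit inside \<open>G\<close> is excluded because \<open>h\<close> is continuous there and recovers \<open>z\<^sub>n\<close>, which leaves
  the disc.\<close>
lemma impression_subset_X: "impression \<theta> \<subseteq> X"
proof
  fix x assume "x \<in> impression \<theta>"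
  then obtain z where z: "\<And>n. z n \<in> ball 0 1" "z \<longlonglongrightarrow> cis \<theta>" "(\<lambda>n. \<phi> (z n)) \<longlonglongrightarrow> x"
    unfolding impression_iff_sequence by blast
  have "x \<in> closure G"
    by (rule Lim_in_closed_set [OF closed_closure _ _ z(3)])
       (use z phi in \<open>auto intro!: always_eventually subsetD [OF closure_subset]\<close>)
  moreover have "x \<notin> G"
  proof
    assume "x \<in> G"
    then have "isCont h x" by (rule isCont_h)
    then have "(\<lambda>n. h (\<phi> (z n))) \<longlonglongrightarrow> h x" using z(3) by (rule isCont_tendsto_compose)
    then have "z \<longlonglongrightarrow> h x" using z(1) phi by simp
    then have "h x = cis \<theta>" using z(2) LIMSEQ_unique by blast
    with h [OF \<open>x \<in> G\<close>] show False by simp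
  qed
  ultimately show "x \<in> X" by (simp add: closure_G)
qed

lemma connected_impression: "connected (impression \<theta>)"
  unfolding impression_def
proof (rule connected_nest)
  fix n
  have "bounded (closure (\<phi> ` (ball 0 1 \<inter> ball (cis \<theta>) (1 / real (Suc n)))))"
    by (rule bounded_closure, rule bounded_subset [OF boundedG]) (use phi in auto)
  then show "compact (closure (\<phi> ` (ball 0 1 \<inter> ball (cis \<theta>) (1 / real (Suc n)))))"
    by (simp add: compact_eq_bounded_closed)
  show "connected (closure (\<phi> ` (ball 0 1 \<inter> ball (cis \<theta>) (1 / real (Suc n)))))"
    by (intro connected_imp_connected_closure connected_continuous_image
        continuous_on_subset [OF cont_phi] convex_connected convex_Int) auto
next
  fix m n :: nat assume "m \<le> n"
  then have "ball (cis \<theta>) (1 / real (Suc n)) \<subseteq> ball (cis \<theta>) (1 / real (Suc m))"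
    by (intro subset_ball) (simp add: field_simps)
  then show "closure (\<phi> ` (ball 0 1 \<inter> ball (cis \<theta>) (1 / real (Suc n)))) \<subseteq>
      closure (\<phi> ` (ball 0 1 \<inter> ball (cis \<theta>) (1 / real (Suc m))))"
    by (intro closure_mono image_mono) auto
qed

text \<open>Pull a sequence in \<open>G\<close> back to the disc and use compactness of the closed disc; the limit cannot lie
  inside the open disc since \<open>\<phi>\<close> maps that into \<open>G\<close>.\<close>
lemma X_eq_Union_impression: "X = (\<Union>\<theta>. impression \<theta>)"
proof
  show "(\<Union>\<theta>. impression \<theta>) \<subseteq> X" using impression_subset_X by blast
  show "X \<subseteq> (\<Union>\<theta>. impression \<theta>)"
  proof
    fix x assume x: "x \<in> X"
    then have "x \<in> closure G" by (simp add: closure_G)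
    then obtain g where g: "\<And>n. g n \<in> G" "g \<longlonglongrightarrow> x" by (auto simp: closure_sequential)
    have "\<forall>n. h (g n) \<in> cball 0 1" using g h by (auto simp: less_imp_le)
    then obtain \<zeta> r where r: "\<zeta> \<in> cball 0 1" "strict_mono (r :: nat \<Rightarrow> nat)" "((\<lambda>n. h (g n)) \<circ> r) \<longlonglongrightarrow> \<zeta>"
      using compact_cball [of "0 :: complex" 1] unfolding compact_def by meson
    have gr: "(\<lambda>n. g (r n)) \<longlonglongrightarrow> x" using LIMSEQ_subseq_LIMSEQ [OF g(2) r(2)] by (simp add: o_def)
    have hr: "(\<lambda>n. h (g (r n))) \<longlonglongrightarrow> \<zeta>" using r by (simp add: o_def)
    have gg: "g (r n) = \<phi> (h (g (r n)))" for n using h g by simp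
    have "norm \<zeta> = 1"
    proof (rule ccontr)
      assume "norm \<zeta> \<noteq> 1"
      then have \<zeta>: "\<zeta> \<in> ball 0 1" using r by auto
      then have "isCont \<phi> \<zeta>" by (rule isCont_phi)
      then have "(\<lambda>n. \<phi> (h (g (r n)))) \<longlonglongrightarrow> \<phi> \<zeta>" using hr by (rule isCont_tendsto_compose)
      then have "x = \<phi> \<zeta>" using gr gg LIMSEQ_unique by simp
      then show False using phi [OF \<zeta>] x X_disjoint by auto
    qed
    then obtain \<theta> where "\<zeta> = cis \<theta>" using unit_complex_eq_cis by blast
    then have "x \<in> impression \<theta>"
      unfolding impression_iff_sequence
      by (intro exI [of _ "\<lambda>n. h (g (r n))"]) (use hr gr gg h g in auto)
    then show "x \<in> (\<Union>\<theta>. impression \<theta>)" by blast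
  qed
qed

lemma X_subset_of_period:
  assumes "\<And>\<theta>. \<lbrakk>c \<le> \<theta>; \<theta> < c + 2 * pi\<rbrakk> \<Longrightarrow> impression \<theta> \<subseteq> Q"
  shows "X \<subseteq> Q"
proof -
  have "impression \<theta> \<subseteq> Q" for \<theta>
  proof -
    define k where "k = \<lfloor>(\<theta> - c) / (2 * pi)\<rfloor>"
    have "k \<le> (\<theta> - c) / (2 * pi)" "(\<theta> - c) / (2 * pi) < k + 1" by (auto simp: k_def)
    then have "k * (2 * pi) \<le> \<theta> - c" "\<theta> - c < (k + 1) * (2 * pi)"
      by (simp_all add: pos_le_divide_eq pos_divide_less_eq)
    then have "impression (\<theta> + 2 * pi * of_int (- k)) \<subseteq> Q"
      by (intro assms) (simp_all add: algebra_simps)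
    then show ?thesis using impression_cis [OF cis_shift] by metis
  qed
  then show ?thesis unfolding X_eq_Union_impression by blast
qed

lemma impression_rotate: "impression (\<theta> + \<alpha>) = F ` impression \<theta>"
proof
  have isF: "isCont F x" for x using contF by (simp add: continuous_on_eq_continuous_at)
  show "F ` impression \<theta> \<subseteq> impression (\<theta> + \<alpha>)"
  proof clarify
    fix x assume "x \<in> impression \<theta>"
    then obtain z where z: "\<And>n. z n \<in> ball 0 1" "z \<longlonglongrightarrow> cis \<theta>" "(\<lambda>n. \<phi> (z n)) \<longlonglongrightarrow> x"
      unfolding impression_iff_sequence by blast
    have "(\<lambda>n. cis \<alpha> * z n) \<longlonglongrightarrow> cis (\<theta> + \<alpha>)"
      using tendsto_mult_left [OF z(2), of "cis \<alpha>"] by (simp add: cis_mult add.commute)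
    moreover have "(\<lambda>n. \<phi> (cis \<alpha> * z n)) \<longlonglongrightarrow> F x"
      using isCont_tendsto_compose [OF isF z(3)] z(1) semiconj by simp
    ultimately show "F x \<in> impression (\<theta> + \<alpha>)"
      unfolding impression_iff_sequence
      by (intro exI [of _ "\<lambda>n. cis \<alpha> * z n"]) (use z in \<open>auto simp: norm_mult\<close>)
  qed
  show "impression (\<theta> + \<alpha>) \<subseteq> F ` impression \<theta>"
  proof
    fix y assume "y \<in> impression (\<theta> + \<alpha>)"
    then obtain z where z: "\<And>n. z n \<in> ball 0 1" "z \<longlonglongrightarrow> cis (\<theta> + \<alpha>)" "(\<lambda>n. \<phi> (z n)) \<longlonglongrightarrow> y"
      unfolding impression_iff_sequence by blast
    define u where "u n = cis (- \<alpha>) * z n" for n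
    have u: "u n \<in> ball 0 1" "cis \<alpha> * u n = z n" for n
      using z(1)[of n] by (auto simp: u_def norm_mult cis_mult simp flip: mult.assoc)
    have ulim: "u \<longlonglongrightarrow> cis \<theta>"
      using tendsto_mult_left [OF z(2), of "cis (- \<alpha>)"] by (simp add: cis_mult u_def [abs_def])
    have "compact (closure G)" using boundedG by (simp add: compact_eq_bounded_closed bounded_closure)
    moreover have "\<forall>n. \<phi> (u n) \<in> closure G" using u phi closure_subset by blast
    ultimately obtain x r where r: "strict_mono (r :: nat \<Rightarrow> nat)" "((\<lambda>n. \<phi> (u n)) \<circ> r) \<longlonglongrightarrow> x"
      unfolding compact_def by meson
    then have x: "(\<lambda>n. \<phi> (u (r n))) \<longlonglongrightarrow> x" by (simp add: o_def)
    have "(\<lambda>n. u (r n)) \<longlonglongrightarrow> cis \<theta>" using LIMSEQ_subseq_LIMSEQ [OF ulim r(1)] by (simp add: o_def)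
    with x u have "x \<in> impression \<theta>"
      unfolding impression_iff_sequence by (intro exI [of _ "\<lambda>n. u (r n)"]) auto
    have "(\<lambda>n. F (\<phi> (u (r n)))) \<longlonglongrightarrow> F x" using isCont_tendsto_compose [OF isF x] .
    moreover have "F (\<phi> (u (r n))) = \<phi> (z (r n))" for n using u(2) [of "r n"] semiconj [OF u(1) [of "r n"]] by simp
    ultimately have "(\<lambda>n. \<phi> (z (r n))) \<longlonglongrightarrow> F x" by simp
    moreover have "(\<lambda>n. \<phi> (z (r n))) \<longlonglongrightarrow> y" using LIMSEQ_subseq_LIMSEQ [OF z(3) r(1)] by (simp add: o_def)
    ultimately have "y = F x" using LIMSEQ_unique by blast
    with \<open>x \<in> impression \<theta>\<close> show "y \<in> F ` impression \<theta>" by blast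
  qed
qed

lemma impression_rotate_iter: "impression (\<theta> + real n * \<alpha>) = (F ^^ n) ` impression \<theta>"
proof (induction n)
  case 0
  show ?case by simp
next
  case (Suc n)
  have eq: "\<theta> + real (Suc n) * \<alpha> = (\<theta> + real n * \<alpha>) + \<alpha>" by (simp add: algebra_simps)
  show ?case unfolding eq impression_rotate [of "\<theta> + real n * \<alpha>"] Suc.IH by (simp add: image_image)
qed

lemma F_iter_X: "(F ^^ n) ` X = X"
proof -
  have "(F ^^ n) ` X = (\<Union>\<theta>. impression (\<theta> + real n * \<alpha>))"
    unfolding X_eq_Union_impression image_UN impression_rotate_iter ..
  also have "\<dots> = X"
    unfolding X_eq_Union_impression
  proof (intro equalityI subsetI)
    fix x assume "x \<in> (\<Union>\<theta>. impression \<theta>)"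
    then obtain \<theta> where "x \<in> impression \<theta>" by blast
    then have "x \<in> impression ((\<theta> - real n * \<alpha>) + real n * \<alpha>)" by simp
    then show "x \<in> (\<Union>\<theta>. impression (\<theta> + real n * \<alpha>))" by (rule UN_I [OF UNIV_I])
  qed auto
  finally show ?thesis .
qed

lemma continuous_F_iter: "continuous_on S (F ^^ n)"
proof (induction n)
  case (Suc n)
  then show ?case
    using continuous_on_compose2 [OF contF] by auto
qed (auto simp: id_def)

section \<open>Accessible boundary points and the crosscut lemma\<close>

text \<open>The point \<open>x\<close> is the landing point of the image of a curve that ends at \<open>cis \<theta>\<close>.\<close>
definition accessible :: "real \<Rightarrow> complex \<Rightarrow> bool" where
  "accessible \<theta> x \<longleftrightarrow> (\<exists>v. path v \<and> v 1 = cis \<theta> \<and> (\<forall>t. 0 \<le> t \<longrightarrow> t < 1 \<longrightarrow> v t \<in> ball 0 1) \<and>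
     ((\<lambda>t. \<phi> (v t)) \<longlongrightarrow> x) (at_left 1))"

lemma accessible_cis: "cis \<theta> = cis \<theta>' \<Longrightarrow> accessible \<theta> x \<longleftrightarrow> accessible \<theta>' x"
  by (simp add: accessible_def)

lemma accessible_in_impression:
  assumes "accessible \<theta> x" shows "x \<in> impression \<theta>"
proof -
  obtain v where v: "path v" "v 1 = cis \<theta>" "\<And>t. \<lbrakk>0 \<le> t; t < 1\<rbrakk> \<Longrightarrow> v t \<in> ball 0 1"
     "((\<lambda>t. \<phi> (v t)) \<longlongrightarrow> x) (at_left 1)"
    using assms unfolding accessible_def by blast
  define u where "u n = 1 - 1 / real (Suc n)" for n
  have u: "0 \<le> u n" "u n < 1" for n by (auto simp: u_def field_simps)
  have "(\<lambda>n. 1 - inverse (real (Suc n))) \<longlonglongrightarrow> 1 - 0"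
    by (intro tendsto_intros LIMSEQ_inverse_real_of_nat)
  then have ulim: "u \<longlonglongrightarrow> 1" by (simp add: u_def [abs_def] inverse_eq_divide)
  have ufl: "filterlim u (at_left 1) sequentially"
    using ulim u by (auto simp: filterlim_at less_imp_neq intro!: always_eventually)
  have "(\<lambda>n. \<phi> (v (u n))) \<longlonglongrightarrow> x" by (rule filterlim_compose [OF v(4) ufl])
  moreover have "(\<lambda>n. v (u n)) \<longlonglongrightarrow> v 1"
    using v(1) ulim u unfolding path_def
    by (intro continuous_on_tendsto_compose [where s = "{0..1}" and f = v]) (auto simp: less_imp_le intro!: always_eventually)
  ultimately show ?thesis
    unfolding impression_iff_sequence using v u by (intro exI [of _ "\<lambda>n. v (u n)"]) auto
qed

lemma accessible_rotate:
  assumes "accessible \<theta> x" shows "accessible (\<theta> + \<alpha>) (F x)"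
proof -
  obtain v where v: "path v" "v 1 = cis \<theta>" "\<And>t. \<lbrakk>0 \<le> t; t < 1\<rbrakk> \<Longrightarrow> v t \<in> ball 0 1"
     "((\<lambda>t. \<phi> (v t)) \<longlongrightarrow> x) (at_left 1)"
    using assms unfolding accessible_def by blast
  have isF: "isCont F x" using contF by (simp add: continuous_on_eq_continuous_at)
  have "((\<lambda>t. F (\<phi> (v t))) \<longlongrightarrow> F x) (at_left 1)" using isCont_tendsto_compose [OF isF v(4)] .
  moreover have "\<forall>\<^sub>F t in at_left 1. F (\<phi> (v t)) = \<phi> (cis \<alpha> * v t)"
    using eventually_at_left_real [of 0 1] by (rule eventually_mono) (use v semiconj in auto)
  ultimately have "((\<lambda>t. \<phi> (cis \<alpha> * v t)) \<longlongrightarrow> F x) (at_left 1)"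
    using tendsto_cong by force
  moreover have "path (\<lambda>t. cis \<alpha> * v t)" using v(1) unfolding path_def by (intro continuous_intros)
  ultimately show ?thesis
    unfolding accessible_def
    using v by (intro exI [of _ "\<lambda>t. cis \<alpha> * v t"]) (auto simp: norm_mult cis_mult add.commute)
qed

text \<open>Towards a nearest point of the complement, a point of \<open>G\<close> sees a whole disc inside \<open>G\<close> that
  touches the boundary there, as the landing theorem requires.\<close>
lemma accessible_exists: "\<exists>\<theta> x. accessible \<theta> x"
proof -
  define w where "w = \<phi> 0"
  have w: "w \<in> G" using phi [of 0] by (simp add: w_def)
  have "G \<noteq> UNIV" using boundedG not_bounded_UNIV by metis
  then have "- G \<noteq> {}" by auto
  then obtain a where a: "a \<in> - G" "\<And>y. y \<in> - G \<Longrightarrow> dist w a \<le> dist w y"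
    using distance_attains_inf [of "- G" w] openG by auto
  define s where "s = dist w a"
  have s: "0 < s" using w a by (auto simp: s_def)
  have "ball w s \<subseteq> G" using a(2) unfolding s_def by (force simp: subset_iff not_less [symmetric])
  then have "\<exists>\<zeta>. norm \<zeta> = 1 \<and> ((\<lambda>t. h (a + of_real t * (w - a))) \<longlongrightarrow> \<zeta>) (at_right 0)"
    by (intro univalent_inverse_lands [OF hol_phi hol_h openG phi h s]) (use a in \<open>simp_all add: s_def\<close>)
  then obtain \<zeta> where \<zeta>: "norm \<zeta> = 1" "((\<lambda>t. h (a + of_real t * (w - a))) \<longlongrightarrow> \<zeta>) (at_right 0)"
    by blast
  obtain \<theta> where \<theta>: "\<zeta> = cis \<theta>" using \<zeta>(1) unit_complex_eq_cis by blast
  define \<sigma> where "\<sigma> t = a + of_real (1 - t) * (w - a)" for t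
  have \<sigma>G: "\<sigma> t \<in> G" if "0 \<le> t" "t < 1" for t
  proof -
    have "w - \<sigma> t = of_real t * (w - a)" by (simp add: \<sigma>_def algebra_simps)
    then have "dist w (\<sigma> t) = t * s" using that by (simp add: dist_norm norm_mult s_def)
    then have "\<sigma> t \<in> ball w s" using that s by simp
    then show ?thesis using \<open>ball w s \<subseteq> G\<close> by blast
  qed
  define v where "v t = (if t = 1 then \<zeta> else h (\<sigma> t))" for t
  have hs: "((\<lambda>t. h (\<sigma> t)) \<longlongrightarrow> \<zeta>) (at_left 1)"
  proof -
    have "filterlim (\<lambda>t::real. 1 - t) (at_right 0) (at_left 1)"
      by (auto simp: filterlim_at eventually_at_left_field intro!: tendsto_eq_intros exI [of _ 0])
    from filterlim_compose [OF \<zeta>(2) this] show ?thesis by (simp add: \<sigma>_def)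
  qed
  have "continuous_on {0..1} v"
    unfolding continuous_on_def
  proof
    fix t :: real assume t: "t \<in> {0..1}"
    show "(v \<longlongrightarrow> v t) (at t within {0..1})"
    proof (cases "t = 1")
      case True
      have "at 1 within {0..1::real} = at_left 1" by (simp add: at_within_Icc_at_left)
      moreover have "(v \<longlongrightarrow> \<zeta>) (at_left 1)"
        using hs by (rule Lim_transform_eventually) (auto simp: v_def eventually_at_filter)
      ultimately show ?thesis using True by (simp add: v_def)
    next
      case False
      then have "t < 1" using t by auto
      have "isCont h (\<sigma> t)"
        using t \<open>t < 1\<close> by (intro isCont_h \<sigma>G) auto
      moreover have "isCont \<sigma> t" unfolding \<sigma>_def by (intro continuous_intros)
      ultimately have "isCont (\<lambda>t. h (\<sigma> t)) t" by (rule isCont_o2 [rotated])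
      then have "((\<lambda>t. h (\<sigma> t)) \<longlongrightarrow> h (\<sigma> t)) (at t)" by (simp add: isCont_def)
      moreover have "\<forall>\<^sub>F u in at t. h (\<sigma> u) = v u"
      proof -
        have "\<forall>\<^sub>F u in nhds t. u \<in> {..<1}" using \<open>t < 1\<close> by (intro eventually_nhds_in_open) auto
        then show ?thesis
          unfolding eventually_at_filter by (rule eventually_mono) (auto simp: v_def)
      qed
      ultimately have "(v \<longlongrightarrow> h (\<sigma> t)) (at t)" by (rule Lim_transform_eventually)
      then have "(v \<longlongrightarrow> h (\<sigma> t)) (at t within {0..1})" by (rule tendsto_within_subset) auto
      then show ?thesis using False by (simp add: v_def)
    qed
  qed
  moreover have "((\<lambda>t. \<phi> (v t)) \<longlongrightarrow> a) (at_left 1)"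
  proof -
    have "(\<sigma> \<longlongrightarrow> a) (at_left 1)" unfolding \<sigma>_def by (auto intro!: tendsto_eq_intros)
    moreover have "\<forall>\<^sub>F t in at_left 1. \<sigma> t = \<phi> (v t)"
      using eventually_at_left_real [of 0 1] by (rule eventually_mono) (use \<sigma>G h in \<open>auto simp: v_def\<close>)
    ultimately show ?thesis by (rule Lim_transform_eventually)
  qed
  ultimately have "accessible \<theta> a"
    unfolding accessible_def path_def using \<theta> \<sigma>G h
    by (intro exI [of _ v]) (auto simp: v_def)
  then show ?thesis by blast
qed

text \<open>The orbit of a single accessible angle under the rotation is accessible and dense.\<close>
lemma accessible_dense:
  assumes "s < t" obtains \<theta> x where "s < \<theta>" "\<theta> < t" "accessible \<theta> x"
proof -
  obtain \<theta> x where acc: "accessible \<theta> x" using accessible_exists by blast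
  have "accessible (\<theta> + real n * \<alpha>) ((F ^^ n) x)" for n
  proof (induction n)
    case (Suc n)
    have "\<theta> + real (Suc n) * \<alpha> = \<theta> + real n * \<alpha> + \<alpha>" by (simp add: algebra_simps)
    with accessible_rotate [OF Suc.IH] show ?case by (simp only: funpow.simps(2) o_apply)
  qed (use acc in simp)
  moreover obtain n :: nat and k :: int where "s < \<theta> + n * \<alpha> + 2 * pi * k" "\<theta> + n * \<alpha> + 2 * pi * k < t"
    using irrational_rotation_dense [OF irrational assms] by blast
  ultimately show ?thesis using that accessible_cis [OF cis_shift] by metis
qed

text \<open>The image curve together with its landing point is the continuous image of a closed interval.\<close>
lemma compact_landing_trace:
  assumes v: "path v" "\<And>t. \<lbrakk>0 \<le> t; t < 1\<rbrakk> \<Longrightarrow> v t \<in> ball 0 1" "((\<lambda>t. \<phi> (v t)) \<longlongrightarrow> x) (at_left 1)"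
  shows "compact (insert x (\<phi> ` v ` {0..<1}))"
proof -
  define k where "k t = (if t = 1 then x else \<phi> (v t))" for t
  have "continuous_on {0..1} k"
    unfolding continuous_on_def
  proof
    fix t :: real assume t: "t \<in> {0..1}"
    show "(k \<longlongrightarrow> k t) (at t within {0..1})"
    proof (cases "t = 1")
      case True
      have "at 1 within {0..1::real} = at_left 1" by (simp add: at_within_Icc_at_left)
      moreover have "(k \<longlongrightarrow> x) (at_left 1)"
        using v(3) by (rule Lim_transform_eventually) (auto simp: k_def eventually_at_filter)
      ultimately show ?thesis using True by (simp add: k_def)
    next
      case False
      then have t1: "t < 1" using t by auto
      have "isCont \<phi> (v t)" using t t1 by (intro isCont_phi v) auto
      moreover have "(v \<longlongrightarrow> v t) (at t within {0..1})" using v(1) t by (auto simp: path_def continuous_on_def)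
      ultimately have "((\<lambda>t. \<phi> (v t)) \<longlongrightarrow> \<phi> (v t)) (at t within {0..1})" by (rule isCont_tendsto_compose)
      moreover have "\<forall>\<^sub>F u in at t within {0..1}. \<phi> (v u) = k u"
      proof -
        have "\<forall>\<^sub>F u in nhds t. u \<in> {..<1}" using t1 by (intro eventually_nhds_in_open) auto
        then show ?thesis
          unfolding eventually_at_filter by (rule eventually_mono) (auto simp: k_def)
      qed
      ultimately have "(k \<longlongrightarrow> \<phi> (v t)) (at t within {0..1})" by (rule Lim_transform_eventually)
      then show ?thesis using False by (simp add: k_def)
    qed
  qed
  then have "compact (k ` {0..1})" by (intro compact_continuous_image) auto
  moreover have "{0..1::real} = insert 1 {0..<1}" by auto
  then have "k ` {0..1} = insert x (\<phi> ` v ` {0..<1})" by (auto simp: k_def image_image)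
  ultimately show ?thesis by simp
qed

text \<open>If the conclusion fails, there are points of \<open>X - Q\<close> in impressions over both arcs. Near each of
  them there are both points of \<open>G\<close> and points of \<open>U\<close>, which connects the two sides of the
  crosscut in the complement of \<open>S = Q \<union> \<phi>(L)\<close>. Janiszewski's theorem for \<open>S\<close> and the complement of
  \<open>G\<close>, which meet in the connected set \<open>Q\<close>, then connects them in \<open>G - S\<close>, against the separation
  of the disc.\<close>
lemma crosscut_sides:
  assumes acc: "accessible \<theta>1 x1" "accessible \<theta>2 x2" and \<theta>: "\<theta>1 < \<theta>2" "\<theta>2 < \<theta>1 + 2 * pi"
    and Q: "closed Q" "connected Q" "Q \<subseteq> X" "x1 \<in> Q" "x2 \<in> Q"
  shows "(\<forall>\<theta>. \<theta>1 < \<theta> \<longrightarrow> \<theta> < \<theta>2 \<longrightarrow> impression \<theta> \<subseteq> Q) \<or>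
         (\<forall>\<theta>. \<theta>2 < \<theta> \<longrightarrow> \<theta> < \<theta>1 + 2 * pi \<longrightarrow> impression \<theta> \<subseteq> Q)"
proof (rule ccontr)
  assume "\<not> ?thesis"
  then obtain a b xa xb where ab: "\<theta>1 < a" "a < \<theta>2" "\<theta>2 < b" "b < \<theta>1 + 2 * pi"
    and xa: "xa \<in> impression a" "xa \<notin> Q" and xb: "xb \<in> impression b" "xb \<notin> Q" by blast
  obtain v1 where v1: "path v1" "v1 1 = cis \<theta>1" "\<And>t. \<lbrakk>0 \<le> t; t < 1\<rbrakk> \<Longrightarrow> v1 t \<in> ball 0 1"
     "((\<lambda>t. \<phi> (v1 t)) \<longlongrightarrow> x1) (at_left 1)"
    using acc(1) unfolding accessible_def by blast
  obtain v2 where v2: "path v2" "v2 1 = cis \<theta>2" "\<And>t. \<lbrakk>0 \<le> t; t < 1\<rbrakk> \<Longrightarrow> v2 t \<in> ball 0 1"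
     "((\<lambda>t. \<phi> (v2 t)) \<longlongrightarrow> x2) (at_left 1)"
    using acc(2) unfolding accessible_def by blast
  define seg where "seg = closed_segment (v1 0) (v2 0)"
  have seg: "seg \<subseteq> ball 0 1" unfolding seg_def using v1(3)[of 0] v2(3)[of 0] by (intro closed_segment_subset) auto
  define g where "g = reversepath v1 +++ (linepath (v1 0) (v2 0) +++ v2)"
  have ends: "pathstart v1 = v1 0" "pathfinish v1 = cis \<theta>1" "pathstart v2 = v2 0" "pathfinish v2 = cis \<theta>2"
    using v1(2) v2(2) by (simp_all add: pathstart_def pathfinish_def)
  have g: "path g" "pathstart g = cis \<theta>1" "pathfinish g = cis \<theta>2"
    using v1(1) v2(1) ends by (simp_all add: g_def)
  have gim: "path_image g = path_image v1 \<union> seg \<union> path_image v2"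
    using v1(1) v2(1) ends by (simp add: g_def path_image_join seg_def Un_assoc)
  have gD: "g x \<in> ball 0 1" if x: "0 < x" "x < 1" for x
  proof -
    consider "x \<le> 1/2" | "1/2 < x" "x \<le> 3/4" | "3/4 < x" by linarith
    then show ?thesis
    proof cases
      case 1 then show ?thesis using v1(3)[of "1 - 2 * x"] x by (simp add: g_def joinpaths_def reversepath_def)
    next
      case 2
      then have "linepath (v1 0) (v2 0) (2 * (2 * x - 1)) \<in> seg"
        unfolding seg_def by (intro linepath_in_path) auto
      then show ?thesis using 2 seg by (auto simp: g_def joinpaths_def)
    next
      case 3 then show ?thesis using v2(3)[of "2 * (2 * x - 1) - 1"] x by (simp add: g_def joinpaths_def)
    qed
  qed
  obtain e where e: "e > 0" and sep: "\<And>z1 z2 C. \<lbrakk>z1 \<in> ball 0 1 \<inter> ball (cis a) e; z2 \<in> ball 0 1 \<inter> ball (cis b) e;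
      connected C; C \<subseteq> ball 0 1 - path_image g; z1 \<in> C\<rbrakk> \<Longrightarrow> z2 \<notin> C"
    using crosscut_separates_disc [OF g gD ab] by metis
  define L where "L = v1 ` {0..<1} \<union> seg \<union> v2 ` {0..<1}"
  have LD: "L \<subseteq> ball 0 1" using v1(3) v2(3) seg by (auto simp: L_def)
  have "path_image v = insert (v 1) (v ` {0..<1})" for v :: "real \<Rightarrow> complex"
  proof -
    have "{0..1::real} = insert 1 {0..<1}" by auto
    then show ?thesis by (simp add: path_image_def)
  qed
  then have gL: "path_image g \<inter> ball 0 1 \<subseteq> L"
    unfolding gim L_def using v1(2) v2(2) by auto
  define S where "S = Q \<union> \<phi> ` L"
  have S_eq: "S = Q \<union> insert x1 (\<phi> ` v1 ` {0..<1}) \<union> \<phi> ` seg \<union> insert x2 (\<phi> ` v2 ` {0..<1})"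
    using Q by (auto simp: S_def L_def)
  have "compact Q" using Q compact_X by (metis compact_Int_closed inf.absorb_iff2)
  moreover have "compact (\<phi> ` seg)"
    by (intro compact_continuous_image continuous_on_subset [OF cont_phi seg]) (simp add: seg_def)
  ultimately have S: "compact S"
    unfolding S_eq using compact_landing_trace [OF v1(1,3,4)] compact_landing_trace [OF v2(1,3,4)]
    by (intro compact_Un)
  have \<phi>L: "\<phi> ` L \<subseteq> G" using LD phi by auto
  have QG: "Q \<inter> G = {}" using Q X_disjoint by blast
  have US: "U \<inter> S = {}" using U_disjoint Q \<phi>L by (auto simp: S_def closure_G)
  have near: "\<exists>z u. z \<in> ball 0 1 \<inter> ball (cis \<theta>) e \<and> \<phi> z \<notin> S \<and> u \<in> U \<and> connected_component (- S) (\<phi> z) u"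
    if x: "x \<in> impression \<theta>" "x \<notin> Q" for x \<theta>
  proof -
    have xX: "x \<in> X" using x impression_subset_X by blast
    then have "x \<notin> S" using x \<phi>L X_disjoint by (auto simp: S_def)
    then obtain r where r: "r > 0" "ball x r \<subseteq> - S"
      using S open_contains_ball [of "- S"] compact_imp_closed by blast
    have "x \<in> closure (\<phi> ` (ball 0 1 \<inter> ball (cis \<theta>) e))" using x e in_impression_iff by blast
    then obtain z where z: "z \<in> ball 0 1 \<inter> ball (cis \<theta>) e" "dist (\<phi> z) x < r"
      unfolding closure_approachable using r by blast
    have "x \<in> closure U" using xX U_closure by blast
    then obtain u where u: "u \<in> U" "dist u x < r"
      unfolding closure_approachable using r by blast
    have "connected_component (- S) (\<phi> z) u"
      unfolding connected_component_def
      by (intro exI [of _ "ball x r"]) (use r z u in \<open>auto simp: dist_commute\<close>)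
    moreover have "\<phi> z \<notin> S" using r z by (auto simp: dist_commute)
    ultimately show ?thesis using z u by blast
  qed
  obtain z1 u1 where z1: "z1 \<in> ball 0 1 \<inter> ball (cis a) e" "\<phi> z1 \<notin> S" "u1 \<in> U"
    "connected_component (- S) (\<phi> z1) u1" using near [OF xa] by blast
  obtain z2 u2 where z2: "z2 \<in> ball 0 1 \<inter> ball (cis b) e" "\<phi> z2 \<notin> S" "u2 \<in> U"
    "connected_component (- S) (\<phi> z2) u2" using near [OF xb] by blast
  have "connected_component (- S) u1 u2"
    unfolding connected_component_def
    by (intro exI [of _ U]) (use US z1 z2 connU in auto)
  then have "connected_component (- S) (\<phi> z1) (\<phi> z2)"
    using z1 z2 by (meson connected_component_trans connected_component_sym)
  moreover have "connected G"
  proof -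
    have "\<phi> ` ball 0 1 = G" using phi h by (force simp: image_iff)
    then show ?thesis using connected_continuous_image [OF cont_phi] by auto
  qed
  then have "connected_component (- (- G)) (\<phi> z1) (\<phi> z2)"
    using phi z1 z2 by (auto simp: connected_component_def)
  moreover have "S \<inter> - G = Q" using \<phi>L QG by (auto simp: S_def)
  ultimately have "connected_component (- (S \<union> - G)) (\<phi> z1) (\<phi> z2)"
    using S openG Q by (intro Janiszewski) auto
  then obtain C where C: "connected C" "C \<subseteq> G - S" "\<phi> z1 \<in> C" "\<phi> z2 \<in> C"
    unfolding connected_component_def by blast
  have "continuous_on C h"
    using hol_h C(2) holomorphic_on_imp_continuous_on continuous_on_subset by blast
  then have "connected (h ` C)" using C(1) by (intro connected_continuous_image)
  moreover have "h ` C \<subseteq> ball 0 1 - path_image g"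
  proof clarify
    fix y assume y: "y \<in> C"
    then have hy: "h y \<in> ball 0 1" "\<phi> (h y) = y" using C(2) h by auto
    moreover have "h y \<notin> path_image g"
    proof
      assume "h y \<in> path_image g"
      then have "h y \<in> L" using gL hy by blast
      then have "y \<in> S" using hy by (force simp: S_def)
      then show False using y C(2) by blast
    qed
    ultimately show "h y \<in> ball 0 1 - path_image g" by blast
  qed
  moreover have "z1 \<in> h ` C" "z2 \<in> h ` C"
    using z1 z2 C phi by (metis IntD1 imageI)+
  ultimately show False using sep [OF z1(1) z2(1)] by blast
qed

end

section \<open>Arcs of impressions in the presence of a periodic boundary point\<close>

locale rotation_domain_periodic = rotation_domain +
  fixes p :: complex and N :: nat
  assumes p_in_X: "p \<in> X" and N: "N > 0" and p_periodic: "(F ^^ N) p = p"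
begin

text \<open>Some impression contains \<open>p\<close>. Since \<open>p\<close> is fixed by the \<open>N\<close>-th iterate, it also lies in the
  impressions at all angles obtained by adding multiples of \<open>N \<alpha>\<close>; these are dense, and the set
  of angles whose impressions contain \<open>p\<close> is closed.\<close>
lemma periodic_in_impression: "p \<in> impression \<theta>"
proof -
  obtain \<theta>0 where \<theta>0: "p \<in> impression \<theta>0" using p_in_X X_eq_Union_impression by blast
  have step: "p \<in> impression (\<theta>0 + real n * (real N * \<alpha>))" for n
  proof (induction n)
    case (Suc n)
    have "(F ^^ N) p \<in> impression (\<theta>0 + real n * (real N * \<alpha>) + real N * \<alpha>)"
      unfolding impression_rotate_iter using Suc by blast
    moreover have "\<theta>0 + real n * (real N * \<alpha>) + real N * \<alpha> = \<theta>0 + real (Suc n) * (real N * \<alpha>)"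
      by (simp add: algebra_simps)
    ultimately show ?case using p_periodic by simp
  qed (use \<theta>0 in simp)
  have irr: "real N * \<alpha> / (2 * pi) \<notin> \<rat>"
  proof
    assume "real N * \<alpha> / (2 * pi) \<in> \<rat>"
    then have "(real N * \<alpha> / (2 * pi)) / real N \<in> \<rat>" using Rats_divide [OF _ Rats_of_nat] by blast
    then show False using irrational N by simp
  qed
  show ?thesis
    unfolding in_impression_iff
  proof (intro allI impI)
    fix e :: real assume e: "e > 0"
    have "isCont cis \<theta>" unfolding cis_conv_exp [abs_def] by (intro continuous_intros)
    then obtain d where d: "d > 0" "\<And>\<theta>'. dist \<theta>' \<theta> < d \<Longrightarrow> dist (cis \<theta>') (cis \<theta>) < e / 2"
      using e unfolding continuous_at_eps_delta by (metis half_gt_zero)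
    obtain n :: nat and k :: int where nk: "\<theta> - d < \<theta>0 + n * (real N * \<alpha>) + 2 * pi * k"
        "\<theta>0 + n * (real N * \<alpha>) + 2 * pi * k < \<theta> + d"
      using irrational_rotation_dense [OF irr, of "\<theta> - d" "\<theta> + d"] d by auto
    define \<theta>' where "\<theta>' = \<theta>0 + n * (real N * \<alpha>) + 2 * pi * k"
    have "p \<in> impression \<theta>'" using step impression_cis [OF cis_shift] unfolding \<theta>'_def by blast
    then have "p \<in> closure (\<phi> ` (ball 0 1 \<inter> ball (cis \<theta>') (e / 2)))"
      using e in_impression_iff by simp
    moreover have "dist (cis \<theta>') (cis \<theta>) < e / 2" using nk by (intro d) (auto simp: \<theta>'_def dist_real_def)
    then have "ball (cis \<theta>') (e / 2) \<subseteq> ball (cis \<theta>) e" by (simp add: ball_subset_ball_iff)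
    then have "closure (\<phi> ` (ball 0 1 \<inter> ball (cis \<theta>') (e / 2))) \<subseteq> closure (\<phi> ` (ball 0 1 \<inter> ball (cis \<theta>) e))"
      by (intro closure_mono image_mono) auto
    ultimately show "p \<in> closure (\<phi> ` (ball 0 1 \<inter> ball (cis \<theta>) e))" by blast
  qed
qed

lemma connected_X: "connected X"
  unfolding X_eq_Union_impression
  by (rule connected_Union) (use connected_impression periodic_in_impression in blast)+

definition fills_arc :: "real \<Rightarrow> real \<Rightarrow> complex set \<Rightarrow> bool" where
  "fills_arc s t Q \<longleftrightarrow> (\<forall>\<theta>. s < \<theta> \<longrightarrow> \<theta> < t \<longrightarrow> impression \<theta> \<subseteq> Q)"

definition proper_continuum :: "complex set \<Rightarrow> bool" where
  "proper_continuum Q \<longleftrightarrow> closed Q \<and> connected Q \<and> Q \<subseteq> X \<and> Q \<noteq> X"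

lemma fills_arc_shift: "fills_arc (s + 2 * pi * of_int k) (t + 2 * pi * of_int k) Q \<longleftrightarrow> fills_arc s t Q"
proof -
  have "(\<forall>\<theta>. s + 2 * pi * of_int k < \<theta> \<longrightarrow> \<theta> < t + 2 * pi * of_int k \<longrightarrow> impression \<theta> \<subseteq> Q) \<longleftrightarrow>
        (\<forall>\<theta>. s + 2 * pi * of_int k < \<theta> + 2 * pi * of_int k \<longrightarrow> \<theta> + 2 * pi * of_int k < t + 2 * pi * of_int k
            \<longrightarrow> impression (\<theta> + 2 * pi * of_int k) \<subseteq> Q)"
    by (metis diff_add_cancel)
  also have "\<dots> \<longleftrightarrow> fills_arc s t Q"
    using impression_cis [OF cis_shift] by (simp add: fills_arc_def)
  finally show ?thesis by (simp add: fills_arc_def)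
qed

lemma crosscut_fills:
  assumes "accessible \<theta>1 x1" "accessible \<theta>2 x2" "\<theta>1 < \<theta>2" "\<theta>2 < \<theta>1 + 2 * pi"
    and "closed Q" "connected Q" "Q \<subseteq> X" "x1 \<in> Q" "x2 \<in> Q"
  shows "fills_arc \<theta>1 \<theta>2 Q \<or> fills_arc \<theta>2 (\<theta>1 + 2 * pi) Q"
  using crosscut_sides [OF assms] by (simp add: fills_arc_def)

text \<open>Rotate the shorter arc into the longer one by some \<open>n \<alpha>\<close>. The continuum spanned by the impressions
  over the shorter arc is then mapped into \<open>Q\<close> by the \<open>n\<close>-th iterate; it is proper because
  that iterate maps \<open>X\<close> onto \<open>X\<close>.\<close>
lemma fills_shorter_arc:
  assumes fills: "fills_arc s t Q" and Q: "proper_continuum Q" and len: "s' < t'" "t' - s' < t - s"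
  shows "\<exists>Q'. proper_continuum Q' \<and> fills_arc s' t' Q'"
proof -
  obtain n :: nat and k :: int where nk: "s < s' + n * \<alpha> + 2 * pi * k" "s' + n * \<alpha> + 2 * pi * k < s + ((t - s) - (t' - s'))"
    using irrational_rotation_dense [OF irrational, of s "s + ((t - s) - (t' - s'))" s'] len by auto
  define Q' where "Q' = closure (\<Union>\<theta>\<in>{s'<..<t'}. impression \<theta>)"
  have "(F ^^ n) ` (\<Union>\<theta>\<in>{s'<..<t'}. impression \<theta>) \<subseteq> Q"
  proof -
    have "impression (\<theta> + n * \<alpha>) \<subseteq> Q" if "s' < \<theta>" "\<theta> < t'" for \<theta>
    proof -
      have "impression (\<theta> + n * \<alpha> + 2 * pi * k) \<subseteq> Q"
        using fills nk that unfolding fills_arc_def by auto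
      then show ?thesis using impression_cis [OF cis_shift] by blast
    qed
    then show ?thesis unfolding image_UN impression_rotate_iter [symmetric] by (intro UN_least) auto
  qed
  then have "(F ^^ n) ` Q' \<subseteq> Q"
    unfolding Q'_def using continuous_F_iter Q by (intro image_closure_subset) (auto simp: proper_continuum_def)
  then have "Q' \<noteq> X" using F_iter_X [of n] Q by (auto simp: proper_continuum_def)
  moreover have "connected Q'"
    unfolding Q'_def
    by (intro connected_imp_connected_closure connected_Union)
       (use connected_impression periodic_in_impression in blast)+
  moreover have "Q' \<subseteq> X"
    unfolding Q'_def using impression_subset_X by (intro closure_minimal) auto
  moreover have "fills_arc s' t' Q'"
    unfolding fills_arc_def Q'_def using closure_subset by fastforce
  ultimately show ?thesis unfolding proper_continuum_def Q'_def by blast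
qed

text \<open>Otherwise there are arcs slightly longer than a half circle around the angles \<open>0\<close> and \<open>\<pi>\<close>, with
  proper continua \<open>Q1\<close> and \<open>Q2\<close>. They overlap around \<open>-\<pi>/2\<close> and \<open>\<pi>/2\<close>; the union \<open>P\<close> of an impression over each
  overlap is a continuum contained in both \<open>Q1\<close> and \<open>Q2\<close>. The crosscut lemma for \<open>P\<close>
  shows that either the right or the left arc has all its impressions in \<open>P\<close>, whence all impressions lie in \<open>Q2\<close> or
  all lie in \<open>Q1\<close>.\<close>
lemma filled_arc_at_most_half:
  assumes fills: "fills_arc s t Q" and Q: "proper_continuum Q"
  shows "t - s \<le> pi"
proof (rule ccontr)
  assume "\<not> ?thesis"
  then have gt: "pi < t - s" by simp
  define \<epsilon> where "\<epsilon> = min ((t - s - pi) / 4) (pi / 4)"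
  have \<epsilon>: "0 < \<epsilon>" "\<epsilon> < pi / 2" "pi + 2 * \<epsilon> < t - s"
    using gt pi_gt_zero by (auto simp: \<epsilon>_def min_def field_simps)
  obtain Q1 where Q1: "proper_continuum Q1" "fills_arc (- pi/2 - \<epsilon>) (pi/2 + \<epsilon>) Q1"
    using fills_shorter_arc [OF fills Q, of "- pi/2 - \<epsilon>" "pi/2 + \<epsilon>"] \<epsilon> by auto
  obtain Q2 where Q2: "proper_continuum Q2" "fills_arc (pi/2 - \<epsilon>) (3*pi/2 + \<epsilon>) Q2"
    using fills_shorter_arc [OF fills Q, of "pi/2 - \<epsilon>" "3*pi/2 + \<epsilon>"] \<epsilon> by auto
  obtain \<theta>b xb where b: "-pi/2 - \<epsilon> < \<theta>b" "\<theta>b < -pi/2 + \<epsilon>" "accessible \<theta>b xb"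
    using accessible_dense [of "-pi/2 - \<epsilon>" "-pi/2 + \<epsilon>"] \<epsilon> by auto
  obtain \<theta>t xt where t: "pi/2 - \<epsilon> < \<theta>t" "\<theta>t < pi/2 + \<epsilon>" "accessible \<theta>t xt"
    using accessible_dense [of "pi/2 - \<epsilon>" "pi/2 + \<epsilon>"] \<epsilon> by auto
  have I1: "impression \<theta> \<subseteq> Q1" if "- pi/2 - \<epsilon> < \<theta>" "\<theta> < pi/2 + \<epsilon>" for \<theta>
    using Q1 that by (auto simp: fills_arc_def)
  have I2: "impression \<theta> \<subseteq> Q2" if "pi/2 - \<epsilon> < \<theta>" "\<theta> < 3*pi/2 + \<epsilon>" for \<theta>
    using Q2 that by (auto simp: fills_arc_def)
  define P where "P = impression \<theta>b \<union> impression \<theta>t"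
  have P1: "P \<subseteq> Q1" using I1 [of \<theta>b] I1 [of \<theta>t] b t \<epsilon> by (auto simp: P_def)
  have "impression (\<theta>b + 2 * pi * of_int 1) = impression \<theta>b" by (rule impression_cis [OF cis_shift])
  then have P2: "P \<subseteq> Q2" using I2 [of "\<theta>b + 2 * pi"] I2 [of \<theta>t] b t \<epsilon> by (auto simp: P_def)
  have "connected P"
    unfolding P_def by (rule connected_Un) (use connected_impression periodic_in_impression in blast)+
  moreover have "xb \<in> P" "xt \<in> P"
    using accessible_in_impression [OF b(3)] accessible_in_impression [OF t(3)] by (auto simp: P_def)
  moreover have "closed P" "P \<subseteq> X"
    using closed_impression impression_subset_X by (auto simp: P_def)
  ultimately have P: "closed P" "connected P" "P \<subseteq> X" "xb \<in> P" "xt \<in> P" by auto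
  have "fills_arc \<theta>b \<theta>t P \<or> fills_arc \<theta>t (\<theta>b + 2 * pi) P"
    by (rule crosscut_fills [OF b(3) t(3) _ _ P]) (use b t \<epsilon> in auto)
  then show False
  proof
    assume f: "fills_arc \<theta>b \<theta>t P"
    have "X \<subseteq> Q2"
    proof (rule X_subset_of_period [of \<theta>b])
      fix \<theta> assume \<theta>: "\<theta>b \<le> \<theta>" "\<theta> < \<theta>b + 2 * pi"
      consider "\<theta> = \<theta>b" | "\<theta>b < \<theta>" "\<theta> < \<theta>t" | "\<theta>t \<le> \<theta>" using \<theta> by linarith
      then show "impression \<theta> \<subseteq> Q2"
      proof cases
        case 1 then show ?thesis using P2 by (auto simp: P_def)
      next
        case 2 then show ?thesis using f P2 by (auto simp: fills_arc_def)
      next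
        case 3 then show ?thesis using \<theta> b t by (intro I2) auto
      qed
    qed
    then show False using Q2 by (auto simp: proper_continuum_def)
  next
    assume f: "fills_arc \<theta>t (\<theta>b + 2 * pi) P"
    have "X \<subseteq> Q1"
    proof (rule X_subset_of_period [of \<theta>b])
      fix \<theta> assume \<theta>: "\<theta>b \<le> \<theta>" "\<theta> < \<theta>b + 2 * pi"
      show "impression \<theta> \<subseteq> Q1"
      proof (cases "\<theta> \<le> \<theta>t")
        case True then show ?thesis using \<theta> b t by (intro I1) auto
      next
        case False
        then have "impression \<theta> \<subseteq> P" using f \<theta> by (simp add: fills_arc_def)
        then show ?thesis using P1 by blast
      qed
    qed
    then show False using Q1 by (auto simp: proper_continuum_def)
  qed
qed

lemma fills_arc_join:
  assumes "fills_arc s t Q" "fills_arc s' t' Q" "s' < t" shows "fills_arc s t' Q"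
  unfolding fills_arc_def
proof (intro allI impI)
  fix \<theta> assume "s < \<theta>" "\<theta> < t'"
  then show "impression \<theta> \<subseteq> Q"
    using assms by (cases "\<theta> < t") (auto simp: fills_arc_def)
qed

lemma accessible_value_in_filler:
  "accessible \<theta> x \<Longrightarrow> fills_arc s t Q \<Longrightarrow> s < \<theta> \<Longrightarrow> \<theta> < t \<Longrightarrow> x \<in> Q"
  using accessible_in_impression by (auto simp: fills_arc_def)

text \<open>The other alternative of the crosscut lemma would be an arc longer than a half circle.\<close>
lemma crosscut_fills_short:
  assumes "accessible \<theta>1 x1" "accessible \<theta>2 x2" "\<theta>1 < \<theta>2" "\<theta>2 < \<theta>1 + pi"
    and Q: "proper_continuum Q" "x1 \<in> Q" "x2 \<in> Q"
  shows "fills_arc \<theta>1 \<theta>2 Q"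
proof -
  have "fills_arc \<theta>1 \<theta>2 Q \<or> fills_arc \<theta>2 (\<theta>1 + 2 * pi) Q"
    by (rule crosscut_fills [OF assms(1,2)]) (use assms in \<open>auto simp: proper_continuum_def\<close>)
  moreover have False if "fills_arc \<theta>2 (\<theta>1 + 2 * pi) Q"
    using filled_arc_at_most_half [OF that Q(1)] assms by simp
  ultimately show ?thesis by blast
qed

text \<open>The half circle bound makes the suprema exist. An accessible point of \<open>Q\<close> over an angle outside
  the maximal arc, joined by a crosscut to an angle inside, would enlarge the arc.\<close>
lemma maximal_filled_arc:
  assumes Q: "proper_continuum Q" and fills: "fills_arc s0 t0 Q" "s0 < t0"
  obtains s t where "s \<le> s0" "t0 \<le> t" "fills_arc s t Q"
    "\<And>\<theta> x. \<lbrakk>accessible \<theta> x; t < \<theta>; \<theta> < s + 2 * pi\<rbrakk> \<Longrightarrow> x \<notin> Q"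
proof -
  define T where "T = {t. fills_arc s0 t Q}"
  define S where "S = {s. fills_arc s t0 Q}"
  have "t - s0 \<le> pi" if "t \<in> T" for t
    using that filled_arc_at_most_half [OF _ Q] by (auto simp: T_def)
  then have T: "t0 \<in> T" "bdd_above T"
    using fills by (auto simp: T_def bdd_above_def diff_le_eq intro!: exI [of _ "pi + s0"])
  have "t0 - s \<le> pi" if "s \<in> S" for s
    using that filled_arc_at_most_half [OF _ Q] by (auto simp: S_def)
  then have S: "s0 \<in> S" "bdd_below S"
    using fills by (auto simp: S_def bdd_below_def intro!: exI [of _ "t0 - pi"]) (smt (verit))
  define t where "t = Sup T"
  define s where "s = Inf S"
  have t0: "t0 \<le> t" and s0: "s \<le> s0"
    using S T by (auto simp: t_def s_def intro: cSup_upper cInf_lower)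
  have ft: "fills_arc s0 t Q"
    unfolding fills_arc_def
  proof (intro allI impI)
    fix \<theta> assume "s0 < \<theta>" "\<theta> < t"
    then obtain t' where "t' \<in> T" "\<theta> < t'" using T less_cSup_iff [of T \<theta>] by (auto simp: t_def)
    then show "impression \<theta> \<subseteq> Q" using \<open>s0 < \<theta>\<close> by (auto simp: T_def fills_arc_def)
  qed
  have fs: "fills_arc s t0 Q"
    unfolding fills_arc_def
  proof (intro allI impI)
    fix \<theta> assume "s < \<theta>" "\<theta> < t0"
    then obtain s' where "s' \<in> S" "s' < \<theta>" using S cInf_less_iff [of S \<theta>] by (auto simp: s_def)
    then show "impression \<theta> \<subseteq> Q" using \<open>\<theta> < t0\<close> by (auto simp: S_def fills_arc_def)
  qed
  have f: "fills_arc s t Q" using fs ft fills(2) by (rule fills_arc_join)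
  have "x \<notin> Q" if acc: "accessible \<theta> x" and \<theta>: "t < \<theta>" "\<theta> < s + 2 * pi" for \<theta> x
  proof
    assume "x \<in> Q"
    obtain \<theta>' x' where \<theta>': "s0 < \<theta>'" "\<theta>' < t0" "accessible \<theta>' x'" using accessible_dense [OF fills(2)] .
    have "x' \<in> Q" using accessible_value_in_filler \<theta>' fills by blast
    have "fills_arc \<theta>' \<theta> Q \<or> fills_arc \<theta> (\<theta>' + 2 * pi) Q"
      by (rule crosscut_fills [OF \<theta>'(3) acc])
         (use \<theta> \<theta>' t0 s0 Q \<open>x \<in> Q\<close> \<open>x' \<in> Q\<close> in \<open>auto simp: proper_continuum_def\<close>)
    then show False
    proof
      assume "fills_arc \<theta>' \<theta> Q"
      with fills(1) have "fills_arc s0 \<theta> Q" using \<theta>'(2) by (rule fills_arc_join)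
      then have "\<theta> \<le> t" using T by (auto simp: t_def T_def intro: cSup_upper)
      then show False using \<theta> by simp
    next
      assume "fills_arc \<theta> (\<theta>' + 2 * pi) Q"
      then have "fills_arc (\<theta> - 2 * pi) \<theta>' Q"
        using fills_arc_shift [of "\<theta> - 2 * pi" 1 \<theta>' Q] by simp
      then have "fills_arc (\<theta> - 2 * pi) t0 Q" using fills(1) \<theta>'(1) by (rule fills_arc_join)
      then have "s \<le> \<theta> - 2 * pi" using S by (auto simp: s_def S_def intro: cInf_lower)
      then show False using \<theta> by simp
    qed
  qed
  with f t0 s0 that show ?thesis by blast
qed

text \<open>Outside a maximal arc for \<open>A\<close> all accessible points lie in \<open>B\<close>, so short crosscuts there put all
  impressions into \<open>B\<close>. Both arcs have length at most \<open>\<pi>\<close>, hence exactly \<open>\<pi>\<close>.\<close>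
lemma complementary_half_arcs:
  assumes A: "proper_continuum A" and B: "proper_continuum B" and AB: "A \<union> B = X"
    and fills: "fills_arc s0 t0 A" "s0 < t0"
  shows "\<exists>s. fills_arc s (s + pi) A \<and> fills_arc (s + pi) (s + 2 * pi) B"
proof -
  obtain s t where st: "s \<le> s0" "t0 \<le> t" "fills_arc s t A"
    and out: "\<And>\<theta> x. \<lbrakk>accessible \<theta> x; t < \<theta>; \<theta> < s + 2 * pi\<rbrakk> \<Longrightarrow> x \<notin> A"
    using maximal_filled_arc [OF A fills] by metis
  have inB: "x \<in> B" if "accessible \<theta> x" "t < \<theta>" "\<theta> < s + 2 * pi" for \<theta> x
    using out [OF that] accessible_in_impression [OF that(1)] impression_subset_X AB by blast
  have fB: "fills_arc t (s + 2 * pi) B"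
    unfolding fills_arc_def
  proof (intro allI impI)
    fix \<theta> assume \<theta>: "t < \<theta>" "\<theta> < s + 2 * pi"
    have "max t (\<theta> - 1) < \<theta>" using \<theta> by simp
    then obtain \<theta>1 x1 where 1: "max t (\<theta> - 1) < \<theta>1" "\<theta>1 < \<theta>" "accessible \<theta>1 x1" using accessible_dense by metis
    have "\<theta> < min (s + 2 * pi) (\<theta> + 1)" using \<theta> by simp
    then obtain \<theta>2 x2 where 2: "\<theta> < \<theta>2" "\<theta>2 < min (s + 2 * pi) (\<theta> + 1)" "accessible \<theta>2 x2" using accessible_dense by metis
    have "fills_arc \<theta>1 \<theta>2 B"
      by (rule crosscut_fills_short [OF 1(3) 2(3) _ _ B])
         (use 1 2 pi_gt3 inB [OF 1(3)] inB [OF 2(3)] in auto)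
    then show "impression \<theta> \<subseteq> B" using 1 2 by (auto simp: fills_arc_def)
  qed
  have "t = s + pi"
    using filled_arc_at_most_half [OF st(3) A] filled_arc_at_most_half [OF fB B] by simp
  then show ?thesis using st fB by blast
qed

lemma not_decomposable:
  assumes A: "proper_continuum A" and B: "proper_continuum B" and AB: "A \<union> B = X"
  shows False
proof -
  obtain s where sA: "fills_arc s (s + pi) A" and sB: "fills_arc (s + pi) (s + 2 * pi) B"
  proof -
    (* Of three accessible points two lie in the same part, and the crosscut between them fills a first arc. *)
    obtain \<theta>1 x1 where 1: "0 < \<theta>1" "\<theta>1 < 1" "accessible \<theta>1 x1" using accessible_dense [of 0 1] by auto
    obtain \<theta>2 x2 where 2: "1 < \<theta>2" "\<theta>2 < 2" "accessible \<theta>2 x2" using accessible_dense [of 1 2] by auto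
    obtain \<theta>3 x3 where 3: "2 < \<theta>3" "\<theta>3 < 3" "accessible \<theta>3 x3" using accessible_dense [of 2 3] by auto
    have "x1 \<in> A \<union> B" "x2 \<in> A \<union> B" "x3 \<in> A \<union> B"
      using 1 2 3 accessible_in_impression impression_subset_X AB by blast+
    then have "\<exists>Q. (Q = A \<or> Q = B) \<and> (x1 \<in> Q \<and> x2 \<in> Q \<or> x2 \<in> Q \<and> x3 \<in> Q \<or> x1 \<in> Q \<and> x3 \<in> Q)" by blast
    then obtain Q where Q: "Q = A \<or> Q = B"
      and two: "x1 \<in> Q \<and> x2 \<in> Q \<or> x2 \<in> Q \<and> x3 \<in> Q \<or> x1 \<in> Q \<and> x3 \<in> Q" by blast
    have proper: "proper_continuum Q" using Q A B by blast
    have "fills_arc \<theta>1 \<theta>2 Q \<or> fills_arc \<theta>2 \<theta>3 Q \<or> fills_arc \<theta>1 \<theta>3 Q"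
      using two
    proof (elim disjE conjE)
      assume "x1 \<in> Q" "x2 \<in> Q"
      then show ?thesis using 1 2 pi_gt3 proper by (intro disjI1 crosscut_fills_short [OF 1(3) 2(3)]) auto
    next
      assume "x2 \<in> Q" "x3 \<in> Q"
      then show ?thesis using 2 3 pi_gt3 proper by (intro disjI2 disjI1 crosscut_fills_short [OF 2(3) 3(3)]) auto
    next
      assume "x1 \<in> Q" "x3 \<in> Q"
      then show ?thesis using 1 3 pi_gt3 proper by (intro disjI2 crosscut_fills_short [OF 1(3) 3(3)]) auto
    qed
    moreover have "\<theta>1 < \<theta>2" "\<theta>2 < \<theta>3" "\<theta>1 < \<theta>3" using 1 2 3 by auto
    ultimately have "\<exists>s0 t0. s0 < t0 \<and> fills_arc s0 t0 Q" by blast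
    then have "\<exists>s0 t0. s0 < t0 \<and> (fills_arc s0 t0 A \<or> fills_arc s0 t0 B)" using Q by blast
    then obtain s0 t0 where "s0 < t0" "fills_arc s0 t0 A \<or> fills_arc s0 t0 B" by blast
    then show ?thesis
    proof (elim disjE)
      assume "s0 < t0" "fills_arc s0 t0 A"
      then show ?thesis using complementary_half_arcs [OF A B AB] that by blast
    next
      assume "s0 < t0" "fills_arc s0 t0 B"
      then obtain s where s: "fills_arc s (s + pi) B" "fills_arc (s + pi) (s + 2 * pi) A"
        using complementary_half_arcs [OF B A] AB by blast
      then have "fills_arc (s + 2 * pi) (s + 3 * pi) B"
        using fills_arc_shift [of s 1 "s + pi" B] by (simp add: algebra_simps)
      then show ?thesis using s by (intro that [of "s + pi"]) (auto simp: algebra_simps)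
    qed
  qed
  have pA: "p \<in> A"
  proof -
    have "impression (s + pi / 2) \<subseteq> A" using sA by (auto simp: fills_arc_def)
    then show ?thesis using periodic_in_impression by blast
  qed
  (* The crosscut from a point over the first half circle would extend that half circle. *)
  have no_accessible: False
    if Q: "proper_continuum Q" "A \<subseteq> Q" and acc: "accessible \<theta> x" "x \<in> Q" "s + pi < \<theta>" "\<theta> < s + 2 * pi" for Q \<theta> x
  proof -
    have sQ: "fills_arc s (s + pi) Q" using sA Q(2) by (auto simp: fills_arc_def)
    obtain \<theta>' x' where \<theta>': "s < \<theta>'" "\<theta>' < s + pi" "accessible \<theta>' x'"
      using accessible_dense [of s "s + pi"] by auto
    have "x' \<in> Q" using accessible_value_in_filler [OF \<theta>'(3) sQ] \<theta>' by blast
    have "fills_arc \<theta>' \<theta> Q \<or> fills_arc \<theta> (\<theta>' + 2 * pi) Q"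
      by (rule crosscut_fills [OF \<theta>'(3) acc(1)])
         (use \<theta>' acc Q \<open>x' \<in> Q\<close> in \<open>auto simp: proper_continuum_def\<close>)
    then show False
    proof
      assume "fills_arc \<theta>' \<theta> Q"
      with sQ have "fills_arc s \<theta> Q" using \<theta>'(2) by (rule fills_arc_join)
      then show False using filled_arc_at_most_half [OF _ Q(1)] acc by fastforce
    next
      assume "fills_arc \<theta> (\<theta>' + 2 * pi) Q"
      moreover have "fills_arc (s + 2 * pi) (s + pi + 2 * pi) Q"
        using fills_arc_shift [of s 1 "s + pi" Q] sQ by simp
      ultimately have "fills_arc \<theta> (s + pi + 2 * pi) Q" by (rule fills_arc_join) (use \<theta>'(1) in simp)
      then show False using filled_arc_at_most_half [OF _ Q(1)] acc by fastforce
    qed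
  qed
  have impB: "proper_continuum (impression \<theta>)" if "s + pi < \<theta>" "\<theta> < s + 2 * pi" for \<theta>
  proof -
    have "impression \<theta> \<subseteq> B" using sB that by (auto simp: fills_arc_def)
    then show ?thesis
      using B closed_impression connected_impression by (auto simp: proper_continuum_def)
  qed
  have cover: "A \<union> impression \<theta> = X" if \<theta>: "s + pi < \<theta>" "\<theta> < s + 2 * pi" "accessible \<theta> x" for \<theta> x
  proof (rule ccontr)
    assume "A \<union> impression \<theta> \<noteq> X"
    moreover have "connected (A \<union> impression \<theta>)"
      using A connected_impression pA periodic_in_impression
      by (intro connected_Un) (auto simp: proper_continuum_def)
    ultimately have "proper_continuum (A \<union> impression \<theta>)"
      using A closed_impression impression_subset_X by (auto simp: proper_continuum_def)
    then show False
      using no_accessible [OF _ _ \<theta>(3) _ \<theta>(1,2)] accessible_in_impression [OF \<theta>(3)] by blast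
  qed
  have const: "impression \<theta>' \<subseteq> impression \<theta>"
    if \<theta>: "s + pi < \<theta>" "\<theta> < s + 2 * pi" "accessible \<theta> x" and \<theta>': "s + pi < \<theta>'" "\<theta>' < s + 2 * pi" for \<theta> \<theta>' x
  proof -
    obtain \<theta>1 x1 where 1: "s + pi < \<theta>1" "\<theta>1 < \<theta>'" "accessible \<theta>1 x1" using accessible_dense \<theta>'(1) by metis
    obtain \<theta>2 x2 where 2: "\<theta>' < \<theta>2" "\<theta>2 < s + 2 * pi" "accessible \<theta>2 x2" using accessible_dense \<theta>'(2) by metis
    have "x1 \<in> X" "x2 \<in> X" using 1 2 accessible_in_impression impression_subset_X by blast+
    then have "x1 \<in> impression \<theta>" "x2 \<in> impression \<theta>"
      using cover [OF \<theta>] no_accessible [OF A subset_refl 1(3)] no_accessible [OF A subset_refl 2(3)] 1 2 \<theta>' by auto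
    then have "fills_arc \<theta>1 \<theta>2 (impression \<theta>)"
      by (intro crosscut_fills_short [OF 1(3) 2(3)] impB) (use 1 2 \<theta> in auto)
    then show ?thesis using 1 2 by (auto simp: fills_arc_def)
  qed
  (* The rotation angle reduced to the interval from -pi to pi; by irrationality it is neither zero nor an end point. *)
  define \<delta> where "\<delta> = \<alpha> - 2 * pi * of_int (round (\<alpha> / (2 * pi)))"
  have "\<bar>of_int (round (\<alpha> / (2 * pi))) - \<alpha> / (2 * pi)\<bar> \<le> 1 / 2" by (rule of_int_round_abs_le)
  then have "2 * pi * \<bar>of_int (round (\<alpha> / (2 * pi))) - \<alpha> / (2 * pi)\<bar> \<le> 2 * pi * (1 / 2)"
    by (rule mult_left_mono) simp
  also have "2 * pi * (1 / 2) = pi" by simp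
  finally have "2 * pi * \<bar>of_int (round (\<alpha> / (2 * pi))) - \<alpha> / (2 * pi)\<bar> \<le> pi" .
  moreover have "\<bar>\<delta>\<bar> = 2 * pi * \<bar>of_int (round (\<alpha> / (2 * pi))) - \<alpha> / (2 * pi)\<bar>"
  proof -
    have "\<delta> = - (2 * pi * (of_int (round (\<alpha> / (2 * pi))) - \<alpha> / (2 * pi)))"
      by (simp add: \<delta>_def right_diff_distrib)
    then show ?thesis by (simp add: abs_mult)
  qed
  ultimately have "\<bar>\<delta>\<bar> \<le> pi" by (simp only:)
  then have \<delta>: "-pi \<le> \<delta>" "\<delta> \<le> pi" by auto
  have "\<delta> \<noteq> pi * of_int k" for k :: int
  proof
    assume "\<delta> = pi * of_int k"
    then have "\<alpha> / (2 * pi) = of_int k / 2 + of_int (round (\<alpha> / (2 * pi)))"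
      by (simp add: \<delta>_def field_simps)
    moreover have "real_of_int k / 2 + of_int (round (\<alpha> / (2 * pi))) \<in> \<rat>" by (intro Rats_add Rats_divide) auto
    ultimately have "\<alpha> / (2 * pi) \<in> \<rat>" by (simp only:)
    then show False using irrational by contradiction
  qed
  from this [of 0] this [of 1] this [of "-1"] have "\<delta> \<noteq> 0" "\<delta> \<noteq> pi" "\<delta> \<noteq> - pi" by auto
  have rot: "impression (\<theta> + \<delta>) = F ` impression \<theta>" and
    rotacc: "accessible \<theta> x \<Longrightarrow> accessible (\<theta> + \<delta>) (F x)" for \<theta> x
  proof -
    have "cis (\<theta> + \<delta>) = cis (\<theta> + \<alpha>)"
      using cis_shift [of "\<theta> + \<delta>" "round (\<alpha> / (2 * pi))"] by (simp add: \<delta>_def)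
    then show "impression (\<theta> + \<delta>) = F ` impression \<theta>"
      "accessible \<theta> x \<Longrightarrow> accessible (\<theta> + \<delta>) (F x)"
      using impression_cis impression_rotate accessible_cis accessible_rotate by metis+
  qed
  (* The rotation moves a, chosen near one end, out of the half circle and keeps b inside. *)
  obtain a b where ab: "s + pi < a" "a < s + 2 * pi" "s + pi < b" "b < s + 2 * pi" "\<exists>x. accessible a x" "\<exists>x. accessible b x"
    "s + pi < b + \<delta>" "b + \<delta> < s + 2 * pi"
    "(s < a + \<delta> \<and> a + \<delta> < s + pi) \<or> (s + 2 * pi < a + \<delta> \<and> a + \<delta> < s + 3 * pi)"
  proof (cases "\<delta> > 0")
    case True
    obtain a xa where "s + 2 * pi - \<delta> < a" "a < s + 2 * pi" "accessible a xa"
      using accessible_dense [of "s + 2 * pi - \<delta>" "s + 2 * pi"] True by auto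
    moreover obtain b xb where "s + pi < b" "b < s + 2 * pi - \<delta>" "accessible b xb"
      using accessible_dense [of "s + pi" "s + 2 * pi - \<delta>"] \<delta> \<open>\<delta> \<noteq> pi\<close> by auto
    ultimately show ?thesis using True \<delta> by (intro that [of a b]) auto
  next
    case False
    obtain a xa where "s + pi < a" "a < s + pi - \<delta>" "accessible a xa"
      using accessible_dense [of "s + pi" "s + pi - \<delta>"] False \<open>\<delta> \<noteq> 0\<close> by auto
    moreover obtain b xb where "s + pi - \<delta> < b" "b < s + 2 * pi" "accessible b xb"
      using accessible_dense [of "s + pi - \<delta>" "s + 2 * pi"] \<delta> \<open>\<delta> \<noteq> - pi\<close> by auto
    ultimately show ?thesis using False \<delta> by (intro that [of a b]) auto
  qed
  have "impression a = impression b" using const ab by blast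
  then have eq: "impression (a + \<delta>) = impression (b + \<delta>)" by (simp add: rot)
  have "A \<union> impression (b + \<delta>) = X" using cover ab rotacc by blast
  moreover have "impression (a + \<delta>) \<subseteq> A"
    using ab(9)
  proof
    assume "s < a + \<delta> \<and> a + \<delta> < s + pi"
    then show ?thesis using sA by (auto simp: fills_arc_def)
  next
    assume "s + 2 * pi < a + \<delta> \<and> a + \<delta> < s + 3 * pi"
    moreover have "fills_arc (s + 2 * pi) (s + 3 * pi) A"
      using fills_arc_shift [of s 1 "s + pi" A] sA by (simp add: algebra_simps)
    ultimately show ?thesis by (auto simp: fills_arc_def)
  qed
  ultimately have "A = X" using eq A by (auto simp: proper_continuum_def)
  then show False using A by (simp add: proper_continuum_def)
qed

end

section \<open>Polynomial iteration on the Riemann sphere\<close>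

lemma poly_funpow: "(poly f ^^ n) z = poly ((pcompose f ^^ n) [:0, 1:]) z" for f :: "complex poly"
  by (induction n arbitrary: z) (auto simp: poly_pcompose)

lemma degree_funpow_pcompose: "degree ((pcompose f ^^ n) [:0, 1:]) = degree f ^ n" for f :: "complex poly"
  by (induction n) (auto simp: degree_pcompose)

lemma sphere_map_funpow_Some: "(sphere_map f ^^ n) (Some z) = Some ((poly f ^^ n) z)"
  by (induction n) (auto simp: sphere_map_def)

lemma poly_funpow_holomorphic: "(poly f ^^ n) holomorphic_on S"
proof -
  have "(poly f ^^ n) = poly ((pcompose f ^^ n) [:0, 1:])" using poly_funpow by blast
  then show ?thesis by (simp add: holomorphic_intros)
qed

text \<open>The \<open>n\<close>-th iterate is a polynomial of degree \<open>(degree f)\<^sup>n > 1\<close>, hence differs from the identity.\<close>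
lemma finite_periodic_points:
  fixes f :: "complex poly"
  assumes "degree f \<ge> 2" "n \<ge> 1"
  shows "finite {z. (poly f ^^ n) z = z}"
proof -
  define q where "q = (pcompose f ^^ n) [:0, 1:] - [:0, 1:]"
  have "q \<noteq> 0"
  proof
    assume "q = 0"
    then have "degree ((pcompose f ^^ n) [:0, 1:]) = degree [:0, 1 :: complex:]" by (simp add: q_def)
    then have "degree f ^ n = 1" by (simp add: degree_funpow_pcompose)
    then show False using assms by simp
  qed
  then have "finite {z. poly q z = 0}" by (rule poly_roots_finite)
  then show ?thesis by (simp add: q_def poly_funpow)
qed

lemma escape_radius:
  fixes f :: "complex poly"
  assumes "degree f \<ge> 2"
  obtains R where "R \<ge> 1" "\<And>z. norm z \<ge> R \<Longrightarrow> norm (poly f z) \<ge> 2 * norm z"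
proof -
  obtain a b r where f: "f = pCons a (pCons b r)" by (metis pCons_cases)
  have "r \<noteq> 0" using assms by (auto simp: f split: if_splits)
  then obtain R where R: "\<And>z. R \<le> norm z \<Longrightarrow> norm a + 2 \<le> norm (poly (pCons b r) z)"
    using poly_infinity by metis
  have "norm (poly f z) \<ge> 2 * norm z" if z: "norm z \<ge> max R 1" for z
  proof -
    have "norm (poly f z) \<ge> norm (z * poly (pCons b r) z) - norm a"
      unfolding f poly_pCons [of a] by (metis add.commute norm_diff_ineq)
    moreover have "norm z * (norm a + 2) \<le> norm (z * poly (pCons b r) z)"
      unfolding norm_mult using R z by (intro mult_left_mono) auto
    moreover have "1 * norm a \<le> norm z * norm a" using z by (intro mult_right_mono) auto
    ultimately show ?thesis by (simp add: algebra_simps)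
  qed
  then show ?thesis using that [of "max R 1"] by simp
qed

lemma bounded_orbit_in_escape_ball:
  assumes R: "R \<ge> 1" "\<And>z. norm z \<ge> R \<Longrightarrow> norm (poly f z) \<ge> 2 * norm z"
    and bdd: "bounded (range (\<lambda>n. (poly f ^^ n) z))"
  shows "norm z < R"
proof (rule ccontr)
  assume "\<not> norm z < R"
  then have z: "norm z \<ge> R" by simp
  have grow: "norm ((poly f ^^ n) z) \<ge> 2 ^ n * R" for n
  proof (induction n)
    case (Suc n)
    have "1 * R \<le> 2 ^ n * R" using R by (intro mult_right_mono) auto
    then have "norm ((poly f ^^ n) z) \<ge> R" using Suc by linarith
    then have "norm (poly f ((poly f ^^ n) z)) \<ge> 2 * norm ((poly f ^^ n) z)" by (rule R)
    then show ?case using Suc by simp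
  qed (use z in simp)
  obtain B where B: "\<And>n. norm ((poly f ^^ n) z) \<le> B" using bdd by (auto simp: bounded_iff)
  obtain n where "B < 2 ^ n" using real_arch_pow [of 2 B] by auto
  moreover have "2 ^ n * 1 \<le> 2 ^ n * R" using R by (intro mult_left_mono) auto
  ultimately show False using B [of n] grow [of n] by linarith
qed

lemma homeomorphic_map_Some: "homeomorphic_map euclidean (subtopology riemann_sphere (range Some)) Some"
  using embedding_map_Some [of "euclidean :: complex topology"] by (simp add: embedding_map_def)

lemma compactin_Some_image: "compactin riemann_sphere (Some ` K) \<longleftrightarrow> compact K"
  using homeomorphic_map_compactness_eq [OF homeomorphic_map_Some, of K]
  by (auto simp: compactin_subtopology image_mono)

lemma connectedin_Some_image: "connectedin riemann_sphere (Some ` K) \<longleftrightarrow> connected K"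
  using homeomorphic_map_connectedness_eq [OF homeomorphic_map_Some, of K]
  by (auto simp: connectedin_subtopology image_mono)

lemma closure_of_Some_image:
  assumes "bounded S" shows "riemann_sphere closure_of (Some ` S) = Some ` closure S"
proof
  have "closedin riemann_sphere (Some ` closure S)"
    using assms by (simp add: compact_eq_bounded_closed bounded_closure)
  then show "riemann_sphere closure_of (Some ` S) \<subseteq> Some ` closure S"
    by (intro closure_of_minimal image_mono closure_subset)
  show "Some ` closure S \<subseteq> riemann_sphere closure_of (Some ` S)"
    using continuous_map_image_closure_subset [OF continuous_map_Some, of euclidean S] by simp
qed

lemma frontier_of_Some_image:
  assumes "bounded S" "open S" shows "riemann_sphere frontier_of (Some ` S) = Some ` frontier S"
proof -
  have "riemann_sphere interior_of (Some ` S) = Some ` S"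
    using assms by (intro interior_of_openin) simp
  then show ?thesis
    using assms by (simp add: frontier_of_def closure_of_Some_image frontier_def interior_open image_set_diff)
qed

lemma uniformly_continuous_stereo_cball: "uniformly_continuous_on (cball 0 R) (\<lambda>z. stereo (Some z))"
proof (rule compact_uniformly_continuous)
  have "(cmod z)\<^sup>2 + 1 \<noteq> 0" for z by (smt (verit) zero_le_power2)
  then show "continuous_on (cball 0 R) (\<lambda>z. stereo (Some z))"
    by (auto intro!: continuous_intros)
qed auto

text \<open>Montel's theorem; the chordal metric makes no difference because the inverse stereographic
  projection is uniformly continuous on bounded sets.\<close>
lemma bounded_iterates_imp_fatou:
  fixes f :: "complex poly"
  assumes bnd: "\<And>n z. z \<in> S \<Longrightarrow> norm ((poly f ^^ n) z) \<le> R" and S: "open S"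
  shows "Some ` S \<subseteq> fatou_set f"
proof -
  have "iterates_normal_on (sphere_map f) (Some ` S)"
    unfolding iterates_normal_on_def
  proof
    fix k :: "nat \<Rightarrow> nat"
    define H where "H = {h. h holomorphic_on S \<and> (\<forall>z\<in>S. norm (h z) \<le> R)}"
    have rng: "range (\<lambda>n. poly f ^^ k n) \<subseteq> H"
      using bnd poly_funpow_holomorphic by (auto simp: H_def)
    obtain g r where r: "strict_mono (r :: nat \<Rightarrow> nat)"
      "\<And>z. z \<in> S \<Longrightarrow> (\<lambda>n. (poly f ^^ k (r n)) z) \<longlonglongrightarrow> g z"
      "\<And>K. \<lbrakk>compact K; K \<subseteq> S\<rbrakk> \<Longrightarrow> uniform_limit K ((\<lambda>n. poly f ^^ k n) \<circ> r) g sequentially"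
    proof (rule Montel [OF S _ _ rng])
      show "h holomorphic_on S" if "h \<in> H" for h using that by (simp add: H_def)
      show "\<exists>B. \<forall>h\<in>H. \<forall>z\<in>K. cmod (h z) \<le> B" if "compact K" "K \<subseteq> S" for K
        using that by (intro exI [of _ R]) (auto simp: H_def)
    qed blast
    have g: "norm (g z) \<le> R" if "z \<in> S" for z
      by (rule tendsto_upperbound [OF tendsto_norm [OF r(2) [OF that]]])
         (use bnd that in \<open>auto intro!: always_eventually\<close>)
    show "\<exists>r g. strict_mono r \<and> (\<forall>K. compactin riemann_sphere K \<and> K \<subseteq> Some ` S \<longrightarrow>
        uniform_limit K (\<lambda>n z. stereo ((sphere_map f ^^ k (r n)) z)) (\<lambda>z. stereo (g z)) sequentially)"
    proof (intro exI [of _ r] exI [of _ "map_option g"] conjI allI impI)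
      fix K assume K: "compactin riemann_sphere K \<and> K \<subseteq> Some ` S"
      then obtain K' where K': "K = Some ` K'" "K' \<subseteq> S" by (metis subset_imageE)
      then have "compact K'" using K compactin_Some_image by simp
      have "uniform_limit K' (\<lambda>n z. stereo (Some (((\<lambda>n. poly f ^^ k n) \<circ> r) n z))) ((\<lambda>z. stereo (Some z)) \<circ> g) sequentially"
        by (rule uniform_limit_compose [OF r(3) [OF \<open>compact K'\<close> K'(2)] uniformly_continuous_stereo_cball [of R]])
           (use bnd g K' in \<open>auto intro!: always_eventually\<close>)
      then show "uniform_limit K (\<lambda>n z. stereo ((sphere_map f ^^ k (r n)) z)) (\<lambda>z. stereo (map_option g z)) sequentially"
        by (simp add: K' uniform_limit_iff sphere_map_funpow_Some del: stereo.simps)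
    qed (use r in simp)
  qed
  moreover have "openin riemann_sphere (Some ` S)" using S by simp
  ultimately show ?thesis unfolding fatou_set_def by blast
qed

lemma open_fatou_set: "open {z. Some z \<in> fatou_set f}"
proof -
  have "fatou_set f = \<Union>{U. openin riemann_sphere U \<and> iterates_normal_on (sphere_map f) U}"
    unfolding fatou_set_def by blast
  then have "openin riemann_sphere (fatou_set f)" by (metis (no_types, lifting) mem_Collect_eq openin_Union)
  then have "openin euclidean {z \<in> topspace euclidean. Some z \<in> fatou_set f}"
    by (rule openin_continuous_map_preimage [OF continuous_map_Some])
  then show ?thesis by simp
qed

lemma connected_subset_fatou_component:
  assumes "G \<in> fatou_components f" "connected C" "Some ` C \<subseteq> fatou_set f" "z \<in> C" "Some z \<in> G"
  shows "Some ` C \<subseteq> G"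
proof (rule connected_components_of_maximal)
  show "G \<in> connected_components_of (subtopology riemann_sphere (fatou_set f))"
    using assms(1) by (simp add: fatou_components_def)
  show "connectedin (subtopology riemann_sphere (fatou_set f)) (Some ` C)"
    using assms by (simp add: connectedin_subtopology connectedin_Some_image)
  show "\<not> disjnt G (Some ` C)" using assms by (auto simp: disjnt_def)
qed

text \<open>A disc around a boundary point that misses the unbounded component lies in the boundary and the
  bounded components of its complement. There the iterates are bounded by the maximum
  principle, so the disc belongs to the Fatou set and thereby to the component \<open>G\<close>,
  which is open.\<close>
lemma frontier_subset_closure_outside:
  fixes f :: "complex poly"
  assumes "open G" "bounded G" and bnd: "\<And>n z. z \<in> frontier G \<Longrightarrow> norm ((poly f ^^ n) z) \<le> R"
    and comp: "Some ` G \<in> fatou_components f"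
  shows "frontier G \<subseteq> closure (outside (frontier G))"
proof
  fix x assume x: "x \<in> frontier G"
  show "x \<in> closure (outside (frontier G))"
  proof (rule ccontr)
    assume "x \<notin> closure (outside (frontier G))"
    then obtain e where e: "e > 0" "ball x e \<inter> outside (frontier G) = {}"
      by (auto simp: closure_approachable not_less) (metis disjoint_iff dist_commute linorder_not_less mem_ball)
    have "norm ((poly f ^^ n) z) \<le> R" if z: "z \<in> ball x e" for n z
    proof (cases "z \<in> frontier G")
      case False
      then have zi: "z \<in> inside (frontier G)" using e z inside_Un_outside by blast
      have "bounded (frontier G)" using \<open>bounded G\<close> compact_frontier_bounded compact_imp_bounded by blast
      have "frontier (inside (frontier G)) \<subseteq> frontier G" by (intro frontier_inside_subset) simp
      then have "\<And>w. w \<in> frontier (inside (frontier G)) \<Longrightarrow> norm ((poly f ^^ n) w) \<le> R" using bnd by blast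
      then show ?thesis
        by (rule maximum_modulus_frontier [OF poly_funpow_holomorphic
            holomorphic_on_imp_continuous_on [OF poly_funpow_holomorphic]
            bounded_inside [OF \<open>bounded (frontier G)\<close>] _ zi])
    qed (use bnd in simp)
    then have fat: "Some ` ball x e \<subseteq> fatou_set f" by (intro bounded_iterates_imp_fatou) auto
    have "x \<in> closure G" using x by (simp add: frontier_def)
    then obtain y where y: "y \<in> G" "y \<in> ball x e" using e by (auto simp: closure_approachable dist_commute)
    have "Some ` ball x e \<subseteq> Some ` G"
      by (rule connected_subset_fatou_component [OF comp connected_ball fat y(2)]) (use y in auto)
    then have "x \<in> G" using e by (auto simp: image_subset_iff)
    then show False using x \<open>open G\<close> by (auto simp: frontier_def interior_open)
  qed
qed

section \<open>Siegel disks\<close>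

text \<open>The multiplier of the rotation is no root of unity since only finitely many points are
  periodic of a given period. The point at infinity is fixed, and the rotation fixes only the
  centre of the disc, which is the image of the finite fixed point; so infinity is not in \<open>G\<close>. Orbits in \<open>G\<close>
  stay in compact invariant curves, so they are bounded and \<open>G\<close> lies within an
  escape radius.\<close>
lemma siegel_disk_planar_model:
  fixes f :: "complex poly"
  assumes deg: "degree f \<ge> 2" and siegel: "siegel_disk f G"
  obtains D \<phi> h \<alpha> where "G = Some ` D" "open D" "bounded D" "\<phi> holomorphic_on ball 0 1" "h holomorphic_on D"
    "\<And>z. z \<in> ball 0 1 \<Longrightarrow> \<phi> z \<in> D \<and> h (\<phi> z) = z" "\<And>w. w \<in> D \<Longrightarrow> h w \<in> ball 0 1 \<and> \<phi> (h w) = w"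
    "\<And>z. z \<in> ball 0 1 \<Longrightarrow> \<phi> (cis \<alpha> * z) = poly f (\<phi> z)" "\<alpha> / (2 * pi) \<notin> \<rat>"
proof -
  obtain w k c where comp: "G \<in> fatou_components f" and inv: "sphere_map f ` G = G"
    and w: "Some w \<in> G" "poly f w = w"
    and k: "sphere_holomorphic_on k G" "bij_betw k G (ball 0 1)" and c: "norm c = 1"
    and conj: "\<And>x. x \<in> G \<Longrightarrow> k (sphere_map f x) = c * k x"
    using siegel unfolding siegel_disk_def by blast
  have inj: "inj_on k G" and im: "k ` G = ball 0 1" using k by (auto simp: bij_betw_def)
  have iter: "(sphere_map f ^^ n) x \<in> G \<and> k ((sphere_map f ^^ n) x) = c ^ n * k x" if "x \<in> G" for x n
    using that by (induction n) (use inv conj in \<open>auto simp: mult.assoc\<close>)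
  define D where "D = {z. Some z \<in> G}"
  have "infinite D"
  proof
    assume "finite D"
    moreover have "x \<in> insert None (Some ` D)" if "x \<in> G" for x using that by (cases x) (auto simp: D_def)
    then have "G \<subseteq> insert None (Some ` D)" by blast
    ultimately have "finite G" by (meson finite_imageI finite_insert finite_subset)
    then have "finite (ball (0::complex) 1)" using im by (metis finite_imageI)
    then show False using uncountable_ball [of 1 "0::complex"] by (simp add: countable_finite)
  qed
  have no_root: "c ^ n \<noteq> 1" if n: "n \<ge> 1" for n
  proof
    assume "c ^ n = 1"
    then have "(sphere_map f ^^ n) x = x" if "x \<in> G" for x
      using iter [OF that, of n] by (intro inj_onD [OF inj _ _ that]) auto
    then have "(poly f ^^ n) z = z" if "z \<in> D" for z
      using that sphere_map_funpow_Some [of n f z] by (simp add: D_def)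
    then have "D \<subseteq> {z. (poly f ^^ n) z = z}" by blast
    then show False using finite_periodic_points [OF deg n] \<open>infinite D\<close> finite_subset by blast
  qed
  have "None \<notin> G"
  proof
    assume None: "None \<in> G"
    have "k x = 0" if "x \<in> G" "sphere_map f x = x" for x
      using conj [OF that(1)] that(2) no_root [of 1] by simp
    then have "k None = k (Some w)" using None w by (simp add: sphere_map_def)
    then show False using inj_onD [OF inj _ None w(1)] by simp
  qed
  then have "x \<in> Some ` D" if "x \<in> G" for x using that by (cases x) (auto simp: D_def)
  then have GD: "G = Some ` D" by (auto simp: D_def)
  have "G \<subseteq> fatou_set f"
    using connected_components_of_subset [of G "subtopology riemann_sphere (fatou_set f)"] comp
    by (simp add: fatou_components_def)
  have "open D"
    unfolding open_contains_ball
  proof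
    fix z assume z: "z \<in> D"
    then have "z \<in> {z. Some z \<in> fatou_set f}" using \<open>G \<subseteq> fatou_set f\<close> by (auto simp: D_def)
    then obtain e where e: "e > 0" "ball z e \<subseteq> {z. Some z \<in> fatou_set f}"
      using open_fatou_set open_contains_ball by metis
    have "Some ` ball z e \<subseteq> G"
      by (rule connected_subset_fatou_component [OF comp connected_ball, of z e z]) (use e z in \<open>auto simp: D_def\<close>)
    then show "\<exists>e>0. ball z e \<subseteq> D" using e by (auto simp: D_def)
  qed
  define h where "h z = k (Some z)" for z
  have holh: "h holomorphic_on D"
    using k(1) by (simp add: sphere_holomorphic_on_def h_def [abs_def] D_def)
  have injh: "inj_on h D" using inj by (auto simp: inj_on_def h_def D_def)
  have hD: "h ` D = ball 0 1" using im by (simp add: GD h_def image_image)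
  obtain \<phi> where \<phi>: "\<phi> holomorphic_on h ` D" "\<And>z. z \<in> D \<Longrightarrow> \<phi> (h z) = z"
    using holomorphic_has_inverse [OF holh \<open>open D\<close> injh] by metis
  have hol\<phi>: "\<phi> holomorphic_on ball 0 1" using \<phi> hD by simp
  have \<phi>D: "\<phi> z \<in> D \<and> h (\<phi> z) = z" if z: "z \<in> ball 0 1" for z
  proof -
    obtain y where y: "z = h y" "y \<in> D" using z unfolding hD [symmetric] by (rule imageE)
    show ?thesis unfolding y(1) \<phi>(2) [OF y(2)] using y(2) by simp
  qed
  have h\<phi>: "h z \<in> ball 0 1 \<and> \<phi> (h z) = z" if "z \<in> D" for z
    using imageI [OF that, of h] \<phi>(2) [OF that] unfolding hD by simp
  have orbit: "(poly f ^^ n) z \<in> D \<and> h ((poly f ^^ n) z) = c ^ n * h z" if "z \<in> D" for z n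
    using iter [of "Some z" n] that by (simp add: D_def h_def sphere_map_funpow_Some)
  obtain \<alpha> where \<alpha>: "c = cis \<alpha>" using c unit_complex_eq_cis by blast
  have conj\<phi>: "\<phi> (cis \<alpha> * z) = poly f (\<phi> z)" if "z \<in> ball 0 1" for z
  proof -
    have "poly f (\<phi> z) \<in> D \<and> h (poly f (\<phi> z)) = c * z" using orbit [of "\<phi> z" 1] \<phi>D [OF that] by simp
    then show ?thesis using h\<phi> \<alpha> by metis
  qed
  have irr: "\<alpha> / (2 * pi) \<notin> \<rat>"
  proof
    assume "\<alpha> / (2 * pi) \<in> \<rat>"
    then obtain a b :: int where b: "b > 0" "\<alpha> / (2 * pi) = of_int a / of_int b" by (rule Rats_cases')
    then have "of_int b * \<alpha> = 2 * pi * of_int a" by (simp add: field_simps)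
    then have "cis (real (nat b) * \<alpha>) = cis (2 * pi * of_int a)" using b by simp
    then have "c ^ nat b = 1" by (simp add: \<alpha> Complex.DeMoivre)
    then show False using no_root [of "nat b"] b by simp
  qed
  obtain R where R: "R \<ge> 1" "\<And>z. norm z \<ge> R \<Longrightarrow> norm (poly f z) \<ge> 2 * norm z"
    using escape_radius [OF deg] by blast
  have "norm z < R" if z: "z \<in> D" for z
  proof (rule bounded_orbit_in_escape_ball [OF R])
    have "sphere 0 (norm (h z)) \<subseteq> ball 0 1" using h\<phi> [OF z] by auto
    then have "compact (\<phi> ` sphere 0 (norm (h z)))"
      by (intro compact_continuous_image continuous_on_subset [OF holomorphic_on_imp_continuous_on [OF hol\<phi>]]) auto
    moreover have "(poly f ^^ n) z \<in> \<phi> ` sphere 0 (norm (h z))" for n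
    proof (rule image_eqI)
      show "(poly f ^^ n) z = \<phi> (c ^ n * h z)" using orbit [OF z, of n] h\<phi> by metis
      show "c ^ n * h z \<in> sphere 0 (norm (h z))" using c by (simp add: norm_mult norm_power)
    qed
    ultimately show "bounded (range (\<lambda>n. (poly f ^^ n) z))"
      by (meson bounded_subset compact_imp_bounded image_subsetI)
  qed
  then have "bounded D" by (intro boundedI [of _ R]) (simp add: less_imp_le)
  show ?thesis
    by (rule that [OF GD \<open>open D\<close> \<open>bounded D\<close> hol\<phi> holh \<phi>D h\<phi> conj\<phi> irr])
qed

lemma bounded_iterates_on_frontier:
  fixes f :: "complex poly"
  assumes "bounded D" and inv: "\<And>z. z \<in> D \<Longrightarrow> poly f z \<in> D"
  obtains R where "\<And>n z. z \<in> frontier D \<Longrightarrow> norm ((poly f ^^ n) z) \<le> R"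
proof -
  obtain R where R: "\<And>z. z \<in> D \<Longrightarrow> norm z \<le> R" using \<open>bounded D\<close> by (auto simp: bounded_iff)
  have orbit: "(poly f ^^ n) z \<in> D" if "z \<in> D" for n z using that by (induction n) (auto intro: inv)
  have "(poly f ^^ n) ` closure D \<subseteq> cball 0 R" for n
  proof (rule image_closure_subset)
    show "continuous_on (closure D) (poly f ^^ n)"
      using poly_funpow_holomorphic by (rule holomorphic_on_imp_continuous_on)
    show "(poly f ^^ n) ` D \<subseteq> cball 0 R" using R orbit by auto
  qed auto
  then show ?thesis by (intro that [of R]) (auto simp: frontier_def image_subset_iff)
qed

lemma indecomposable_continuum_Some_image:
  assumes "compact X" "connected X"
    and indec: "\<And>A B. \<lbrakk>closed A; connected A; closed B; connected B; A \<noteq> X; B \<noteq> X\<rbrakk> \<Longrightarrow> A \<union> B \<noteq> X"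
  shows "indecomposable_continuum (subtopology riemann_sphere (Some ` X))"
proof -
  let ?T = "subtopology riemann_sphere (Some ` X)"
  have top: "topspace ?T = Some ` X" by auto
  have part: "\<exists>A'. A = Some ` A' \<and> closed A' \<and> connected A'" if A: "closedin ?T A" "connectedin ?T A" for A
  proof -
    have "A \<subseteq> Some ` X" using closedin_subset [OF A(1)] top by blast
    then obtain A' where A': "A = Some ` A'" by (metis subset_imageE)
    have "closedin riemann_sphere (Some ` X)" using \<open>compact X\<close> by (simp add: compact_imp_closed)
    then have "closedin riemann_sphere A" using A(1) closedin_trans_full by blast
    then have "closed A'" by (simp add: A')
    moreover have "connected A'" using A(2) by (simp add: A' connectedin_subtopology connectedin_Some_image)
    ultimately show ?thesis using A' by blast
  qed
  have "compact_space ?T" using \<open>compact X\<close> by (intro compact_space_subtopology) (simp add: compactin_Some_image)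
  moreover have "connected_space ?T"
    using \<open>connected X\<close> connectedin_Some_image [of X] by (simp add: connectedin_def)
  moreover have False
    if A: "closedin ?T A" "connectedin ?T A" "A \<noteq> topspace ?T"
      and B: "closedin ?T B" "connectedin ?T B" "B \<noteq> topspace ?T" and AB: "topspace ?T = A \<union> B" for A B
  proof -
    obtain A' B' where A': "A = Some ` A'" "closed A'" "connected A'" and B': "B = Some ` B'" "closed B'" "connected B'"
      using part A B by metis
    have "X = A' \<union> B'" using AB unfolding top A' B' by (metis image_Un inj_Some inj_image_eq_iff)
    moreover have "A' \<noteq> X" "B' \<noteq> X" using A(3) B(3) unfolding top A' B' by auto
    ultimately show False using indec A' B' by metis
  qed
  ultimately show ?thesis unfolding indecomposable_continuum_def by blast
qed

theorem theorem1p4: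
  fixes f :: "complex poly" and G :: "complex option set"
  assumes "degree f \<ge> 2"
    and "siegel_disk f G"
    and "\<exists>x \<in> riemann_sphere frontier_of G. periodic_point (sphere_map f) x"
  shows "indecomposable_continuum
           (subtopology riemann_sphere (riemann_sphere frontier_of G))"
proof -
  obtain D \<phi> h \<alpha> where D: "G = Some ` D" "open D" "bounded D"
    and \<phi>: "\<phi> holomorphic_on ball 0 1" "h holomorphic_on D"
      "\<And>z. z \<in> ball 0 1 \<Longrightarrow> \<phi> z \<in> D \<and> h (\<phi> z) = z" "\<And>w. w \<in> D \<Longrightarrow> h w \<in> ball 0 1 \<and> \<phi> (h w) = w"
    and rot: "\<And>z. z \<in> ball 0 1 \<Longrightarrow> \<phi> (cis \<alpha> * z) = poly f (\<phi> z)" "\<alpha> / (2 * pi) \<notin> \<rat>"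
    using siegel_disk_planar_model [OF assms(1,2)] by blast
  have frontier: "riemann_sphere frontier_of G = Some ` frontier D"
    using D frontier_of_Some_image by simp
  obtain p n where p: "p \<in> frontier D" "n \<ge> 1" "(poly f ^^ n) p = p"
    using assms(3) by (auto simp: frontier periodic_point_def sphere_map_funpow_Some)
  have inv: "poly f z \<in> D" if "z \<in> D" for z
  proof -
    have "h z \<in> ball 0 1" "\<phi> (h z) = z" using \<phi>(4) that by auto
    then have "poly f z = \<phi> (cis \<alpha> * h z)" "cis \<alpha> * h z \<in> ball 0 1" using rot(1) [of "h z"] by (auto simp: norm_mult)
    then show ?thesis using \<phi>(3) by simp
  qed
  obtain R where R: "\<And>n z. z \<in> frontier D \<Longrightarrow> norm ((poly f ^^ n) z) \<le> R"
    using bounded_iterates_on_frontier [OF D(3) inv] by blast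
  have comp: "Some ` D \<in> fatou_components f" using assms(2) D by (simp add: siegel_disk_def)
  interpret rotation_domain_periodic "poly f" \<phi> h D "outside (frontier D)" \<alpha> p n
  proof
    show "continuous_on UNIV (poly f)" by (intro continuous_intros)
    show "connected (outside (frontier D))"
      using compact_frontier_bounded [OF D(3)] by (intro connected_outside compact_imp_bounded) simp_all
    show "outside (frontier D) \<inter> closure D = {}" using outside_frontier_misses_closure [OF D(3)] by blast
    show "frontier D \<subseteq> closure (outside (frontier D))"
      by (rule frontier_subset_closure_outside [OF D(2,3) R comp])
  qed (use D \<phi> rot p in auto)
  show ?thesis
    unfolding frontier
  proof (rule indecomposable_continuum_Some_image [OF compact_X connected_X])
    fix A B assume "closed A" "connected A" "closed B" "connected B" "A \<noteq> X" "B \<noteq> X"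
    then show "A \<union> B \<noteq> X"
      using not_decomposable [of A B] by (auto simp: proper_continuum_def)
  qed
qed

end
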